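(* Let $U$ be a box domain in $\mathbb{R}^d$. Assume that $V\in L^\infty(U)$, $u^n\in H^1(U)\cap L^\infty(U)$ and that one of the following holds: (i) $d=1$ and $\alpha_n\ge\frac12\max\left\{0,\ \mathrm{ess\,sup}_{\mathbf{x}\in U}\left(V(\mathbf{x})+\omega-\widetilde\lambda(u^n)|u^n(\mathbf{x})|^{p-1}\right)\right\}$; (ii) $d\ge2$ and $\alpha_n\ge\frac12\max\left\{0,\ \mathrm{ess\,sup}_{\mathbf{x}\in U}\left(V(\mathbf{x})+\frac{|\Omega|^2}{2}(x_1^2+x_2^2)+\omega-\widetilde\lambda(u^n)|u^n(\mathbf{x})|^{p-1}\right)\right\}$. Then the backward-forward Euler scheme $$\frac{\tilde u^{n+1}-u^n}{\tau}=\left(\tfrac12\Delta-\alpha_n\right)\tilde u^{n+1}+\left(\alpha_n-V-\omega+\Omega L_z+\widetilde\lambda(u^n)|u^n|^{p-1}\right)u^n,\qquad u^{n+1}=\frac{\tilde u^{n+1}}{\|\tilde u^{n+1}\|_{L^{p+1}}},$$ on the spatial domain $U$ with the homogeneous Dirichlet or periodic boundary condition has the unconditional energy-decaying property: for any $\tau>0$, $$Q(u^{n+1})\le Q(u^n).$$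
   Context: Here $d\ge1$ is an integer, $\mathbf{x}=(x_1,\dots,x_d)$, $\Omega,\omega\in\mathbb{R}$, and $1<p<\frac{d+2}{d-2}$ if $d\ge3$, $1<p<\infty$ if $d=1,2$. The set $U$ is bounded (an interval if $d=1$, a box if $d\ge2$), and the potential $V$ is real-valued with $V\ge0$. Functions $u$ are complex-valued on $U$, and the chosen boundary condition (homogeneous Dirichlet or periodic) is imposed on all iterates. The angular momentum operator is $L_z=i(x_2\partial_{x_1}-x_1\partial_{x_2})$ if $d\ge2$ and $L_z=0$ if $d=1$. The number $\tau>0$ is the time step and $\alpha_n\ge0$ is a stabilization factor. The scheme is started from some $u^0$ with $\|u^0\|_{L^{p+1}}=1$, so every iterate satisfies $\|u^n\|_{L^{p+1}}=1$, where norms are taken on $U$. The quadratic energy on $U$ is $$Q(u)=\int_U\left(\tfrac12|\nabla u|^2+V|u|^2-\Omega\,\overline{u}\,L_zu+\omega|u|^2\right)d\mathbf{x},$$ and the asymptotic Lagrange multiplier is $\widetilde\lambda(u)=Q(u)\big/\int_U|u|^{p+1}d\mathbf{x}$, so that $\widetilde\lambda(u^n)=Q(u^n)$.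
   Formalization: The formal theorem adds the hypothesis Q(u^n) ≥ 0, i.e. λ̃(u^n) ≥ 0; without it the claim fails, e.g. for d=1, periodic boundary condition, V=0, ω very negative, large τ and u^n a small perturbation of a constant. *)

theory Defs
  imports "HOL-Analysis.Analysis" "HOL-Probability.Essential_Supremum"
begin

text \<open>Functions on an open set \<open>U\<close> are represented by total functions on \<open>real ^ 'n\<close>, of which only
  the values almost everywhere on \<open>U\<close> (with respect to \<open>lebesgue_on U\<close>) are relevant. The
  dimension is \<open>CARD('n)\<close>.\<close>

subsection \<open>Smooth functions and weak derivatives\<close>

definition partial_deriv :: "'n::finite \<Rightarrow> (real ^ 'n \<Rightarrow> complex) \<Rightarrow> real ^ 'n \<Rightarrow> complex" where
  "partial_deriv i f x = frechet_derivative f (at x) (axis i 1)"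

text \<open>All iterated partial derivatives exist and are (Frechet) differentiable everywhere,
  hence continuous.\<close>

definition smooth :: "(real ^ 'n::finite \<Rightarrow> complex) \<Rightarrow> bool" where
  "smooth f \<longleftrightarrow> (\<forall>is x. (foldr partial_deriv is f) differentiable (at x))"

definition test_fun :: "(real ^ 'n::finite) set \<Rightarrow> (real ^ 'n \<Rightarrow> complex) \<Rightarrow> bool" where
  "test_fun U \<phi> \<longleftrightarrow> smooth \<phi> \<and> compact (closure {x. \<phi> x \<noteq> 0}) \<and> closure {x. \<phi> x \<noteq> 0} \<subseteq> U"

definition locally_integrable :: "(real ^ 'n::finite) set \<Rightarrow> (real ^ 'n \<Rightarrow> complex) \<Rightarrow> bool" where
  "locally_integrable U f \<longleftrightarrow> (\<forall>K. compact K \<and> K \<subseteq> U \<longrightarrow> integrable (lebesgue_on K) f)"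

definition has_weak_partial ::
  "(real ^ 'n::finite) set \<Rightarrow> 'n \<Rightarrow> (real ^ 'n \<Rightarrow> complex) \<Rightarrow> (real ^ 'n \<Rightarrow> complex) \<Rightarrow> bool" where
  "has_weak_partial U i u g \<longleftrightarrow>
     locally_integrable U u \<and> locally_integrable U g \<and>
     (\<forall>\<phi>. test_fun U \<phi> \<longrightarrow>
        (\<integral>x. u x * partial_deriv i \<phi> x \<partial>lebesgue_on U) = - (\<integral>x. g x * \<phi> x \<partial>lebesgue_on U))"

text \<open>A weak derivative is determined only up to a null set; one representative is chosen.\<close>

definition weak_partial ::
  "(real ^ 'n::finite) set \<Rightarrow> 'n \<Rightarrow> (real ^ 'n \<Rightarrow> complex) \<Rightarrow> real ^ 'n \<Rightarrow> complex" where
  "weak_partial U i u = (SOME g. has_weak_partial U i u g)"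

subsection \<open>Function spaces\<close>

definition L2_space :: "(real ^ 'n::finite) set \<Rightarrow> (real ^ 'n \<Rightarrow> complex) set" where
  "L2_space U = {f. f \<in> borel_measurable (lebesgue_on U) \<and>
                    integrable (lebesgue_on U) (\<lambda>x. (norm (f x))\<^sup>2)}"

definition Linf_space :: "(real ^ 'n::finite) set \<Rightarrow> (real ^ 'n \<Rightarrow> 'b::euclidean_space) set" where
  "Linf_space U = {f. f \<in> borel_measurable (lebesgue_on U) \<and>
                      (\<exists>C. AE x in lebesgue_on U. norm (f x) \<le> C)}"

definition Lp_norm :: "(real ^ 'n::finite) set \<Rightarrow> real \<Rightarrow> (real ^ 'n \<Rightarrow> complex) \<Rightarrow> real" where
  "Lp_norm U q u = (\<integral>x. norm (u x) powr q \<partial>lebesgue_on U) powr (1 / q)"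

definition H1_space :: "(real ^ 'n::finite) set \<Rightarrow> (real ^ 'n \<Rightarrow> complex) set" where
  "H1_space U = {u. u \<in> L2_space U \<and> (\<forall>i. \<exists>g. g \<in> L2_space U \<and> has_weak_partial U i u g)}"

definition H1_norm :: "(real ^ 'n::finite) set \<Rightarrow> (real ^ 'n \<Rightarrow> complex) \<Rightarrow> real" where
  "H1_norm U u = sqrt ((\<integral>x. (norm (u x))\<^sup>2 \<partial>lebesgue_on U) +
                       (\<Sum>i\<in>UNIV. \<integral>x. (norm (weak_partial U i u x))\<^sup>2 \<partial>lebesgue_on U))"

definition H1_closure ::
  "(real ^ 'n::finite) set \<Rightarrow> (real ^ 'n \<Rightarrow> complex) set \<Rightarrow> (real ^ 'n \<Rightarrow> complex) set" where
  "H1_closure U S = {u. u \<in> H1_space U \<and>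
     (\<exists>\<phi>. (\<forall>k::nat. \<phi> k \<in> S) \<and> (\<lambda>k. H1_norm U (\<lambda>x. u x - \<phi> k x)) \<longlonglongrightarrow> 0)}"

definition box_periodic ::
  "real ^ 'n::finite \<Rightarrow> real ^ 'n \<Rightarrow> (real ^ 'n \<Rightarrow> complex) \<Rightarrow> bool" where
  "box_periodic a b f \<longleftrightarrow> (\<forall>i x. f (x + (b $ i - a $ i) *\<^sub>R axis i 1) = f x)"

datatype boundary_condition = Dirichlet | Periodic

text \<open>The energy space of the boundary condition: \<open>H\<^sup>1\<^sub>0\<close>, the closure of the test functions, or
  \<open>H\<^sup>1\<^sub>per\<close>, the closure of the smooth functions that are periodic with respect to the box.\<close>

fun H1_bc ::
  "boundary_condition \<Rightarrow> real ^ 'n::finite \<Rightarrow> real ^ 'n \<Rightarrow> (real ^ 'n \<Rightarrow> complex) set" where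
  "H1_bc Dirichlet a b = H1_closure (box a b) {\<phi>. test_fun (box a b) \<phi>}"
| "H1_bc Periodic a b = H1_closure (box a b) {\<phi>. smooth \<phi> \<and> box_periodic a b \<phi>}"

subsection \<open>Angular momentum, quadratic energy and Lagrange multiplier\<close>

text \<open>The indices \<open>i1\<close>, \<open>i2\<close> name the first and second coordinate. In dimension one they
  necessarily coincide, and \<open>L\<^sub>z\<close> vanishes.\<close>

definition Lz ::
  "(real ^ 'n::finite) set \<Rightarrow> 'n \<Rightarrow> 'n \<Rightarrow> (real ^ 'n \<Rightarrow> complex) \<Rightarrow> real ^ 'n \<Rightarrow> complex" where
  "Lz U i1 i2 u x = (if CARD('n) = 1 then 0
     else \<i> * (of_real (x $ i2) * weak_partial U i1 u x - of_real (x $ i1) * weak_partial U i2 u x))"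

text \<open>The integrand is complex, because \<open>cnj u * L\<^sub>z u\<close> need not be real pointwise; its integral is
  real under either boundary condition, since \<open>L\<^sub>z\<close> is then symmetric. The function \<open>Re\<close>
  only converts the type.\<close>

definition energy_Q ::
  "(real ^ 'n::finite) set \<Rightarrow> 'n \<Rightarrow> 'n \<Rightarrow> real \<Rightarrow> real \<Rightarrow> (real ^ 'n \<Rightarrow> real) \<Rightarrow>
   (real ^ 'n \<Rightarrow> complex) \<Rightarrow> real" where
  "energy_Q U i1 i2 \<Omega> \<omega> V u = Re (\<integral>x.
      of_real (1 / 2 * (\<Sum>i\<in>UNIV. (norm (weak_partial U i u x))\<^sup>2))
    + of_real (V x * (norm (u x))\<^sup>2)
    - of_real \<Omega> * cnj (u x) * Lz U i1 i2 u x
    + of_real (\<omega> * (norm (u x))\<^sup>2) \<partial>lebesgue_on U)"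

definition lambda_tilde ::
  "(real ^ 'n::finite) set \<Rightarrow> 'n \<Rightarrow> 'n \<Rightarrow> real \<Rightarrow> real \<Rightarrow> (real ^ 'n \<Rightarrow> real) \<Rightarrow> real \<Rightarrow>
   (real ^ 'n \<Rightarrow> complex) \<Rightarrow> real" where
  "lambda_tilde U i1 i2 \<Omega> \<omega> V p u =
     energy_Q U i1 i2 \<Omega> \<omega> V u / (\<integral>x. norm (u x) powr (p + 1) \<partial>lebesgue_on U)"

subsection \<open>The backward-forward Euler scheme\<close>

text \<open>\<open>ut\<close> is a weak solution, with the given boundary condition, of
  \<open>(ut - u) / \<tau> = (\<Delta>/2 - \<alpha>) ut + (\<alpha> - V - \<omega> + \<Omega> L\<^sub>z + lam |u|\<^sup>p\<^sup>-\<^sup>1) u\<close> with \<open>lam = lambda_tilde u\<close>: the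
  equation is multiplied by \<open>cnj \<phi>\<close>, integrated over the box, and \<open>\<Delta>\<close> is integrated by parts.
  In the periodic case this also encodes the periodicity of the normal derivatives.\<close>

definition bfe_weak_solution ::
  "boundary_condition \<Rightarrow> real ^ 'n::finite \<Rightarrow> real ^ 'n \<Rightarrow> 'n \<Rightarrow> 'n \<Rightarrow> real \<Rightarrow> real \<Rightarrow>
   (real ^ 'n \<Rightarrow> real) \<Rightarrow> real \<Rightarrow> real \<Rightarrow> real \<Rightarrow>
   (real ^ 'n \<Rightarrow> complex) \<Rightarrow> (real ^ 'n \<Rightarrow> complex) \<Rightarrow> bool" where
  "bfe_weak_solution bc a b i1 i2 \<Omega> \<omega> V p \<tau> \<alpha> u ut \<longleftrightarrow>
     (let U = box a b; lam = lambda_tilde U i1 i2 \<Omega> \<omega> V p u in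
      ut \<in> H1_bc bc a b \<and>
      (\<forall>\<phi> \<in> H1_bc bc a b.
        (\<integral>x. (ut x - u x) / of_real \<tau> * cnj (\<phi> x) \<partial>lebesgue_on U) =
          - 1 / 2 * (\<integral>x. (\<Sum>i\<in>UNIV. weak_partial U i ut x * cnj (weak_partial U i \<phi> x)) \<partial>lebesgue_on U)
          - of_real \<alpha> * (\<integral>x. ut x * cnj (\<phi> x) \<partial>lebesgue_on U)
          + (\<integral>x. (of_real (\<alpha> - V x - \<omega> + lam * norm (u x) powr (p - 1)) * u x
                  + of_real \<Omega> * Lz U i1 i2 u x) * cnj (\<phi> x) \<partial>lebesgue_on U)))"

definition bfe_step ::
  "boundary_condition \<Rightarrow> real ^ 'n::finite \<Rightarrow> real ^ 'n \<Rightarrow> 'n \<Rightarrow> 'n \<Rightarrow> real \<Rightarrow> real \<Rightarrow>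
   (real ^ 'n \<Rightarrow> real) \<Rightarrow> real \<Rightarrow> real \<Rightarrow> real \<Rightarrow>
   (real ^ 'n \<Rightarrow> complex) \<Rightarrow> (real ^ 'n \<Rightarrow> complex) \<Rightarrow> (real ^ 'n \<Rightarrow> complex) \<Rightarrow> bool" where
  "bfe_step bc a b i1 i2 \<Omega> \<omega> V p \<tau> \<alpha> u ut u' \<longleftrightarrow>
     bfe_weak_solution bc a b i1 i2 \<Omega> \<omega> V p \<tau> \<alpha> u ut \<and>
     (AE x in lebesgue_on (box a b). u' x = ut x / of_real (Lp_norm (box a b) (p + 1) ut))"

end

(* Write u for u^n, w for the unnormalised new iterate, e = w - u, lam = Q(u) and <.,.> for the real
   L^2 pairing. Testing the weak equation with w and with u and subtracting gives, since L_z is symmetric,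
     Q(w) - Q(u) = lam (int |u|^(p-1) |w|^2 - int |u|^(p+1)) - (2/tau) |e|^2 - R,
     R = |grad e|^2 / 2 + <(2 alpha - V - omega + lam |u|^(p-1)) e, e> + Omega <L_z e, e>.
   Completing squares in Omega <L_z e, e> costs |grad e|^2 / 2 + Omega^2/2 (x_1^2 + x_2^2) |e|^2, so R >= 0
   by the bound on alpha. Hoelder's inequality and |u|_{p+1} = 1 then give Q(w) <= lam |w|_{p+1}^2,
   and dividing by |w|_{p+1}^2 gives Q(u^{n+1}) <= lam = Q(u).

   The pairing of L_z with the representatives chosen for weak derivatives needs that weak
   derivatives are unique almost everywhere, and integration by parts for smooth functions with the given
   boundary condition, which passes to the H^1 closure. *)

theory Submission
  imports Defs
begin

subsection \<open>Smooth bump functions\<close>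

text \<open>The chosen weak derivatives are known only up to null sets, so their linearity and
  scaling hold almost everywhere only, and measurability is transferred along such equalities. Their
  uniqueness rests on smooth functions converging boundedly to the indicator of a box; explicit
  products built from exp(-1/t) supply them, without mollification. The passage from the energies to
  the weak equation is an algebraic identity between integrands, over an arbitrary measure: only
  after it is integrated do the tested equations and the symmetry of L_z remove their terms.
  Hoelder's inequality bounds int |u|^(p-1) |w|^2 from above and the bound is then multiplied by
  lam, so the sign of lam matters; \<open>Q_u\<close> provides it, as a negative \<omega> alone
  could make the energy negative.\<close>

definition flat :: "nat \<Rightarrow> real \<Rightarrow> real" where
  "flat m t = (if t > 0 then exp (- (1 / t)) / t ^ m else 0)"

text \<open>The powers of 1/t make the family \<open>flat\<close> closed under differentiation up to
  linear combinations; \<open>flat 0\<close> is the classical function exp(-1/t), extended by 0.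
  Only the origin needs a limit.\<close>

lemma flat_has_derivative:
  "(flat m has_real_derivative flat (m + 2) t - real m * flat (m + 1) t) (at t)"
proof -
  consider "t > 0" | "t < 0" | "t = 0" by linarith
  then show ?thesis
  proof cases
    case 1
    have "((\<lambda>t. exp (- (1 / t)) / t ^ m) has_real_derivative
        (exp (- (1 / t)) * (1 / t\<^sup>2) * t ^ m - exp (- (1 / t)) * (real m * t ^ (m - Suc 0))) / (t ^ m * t ^ m)) (at t)"
      using 1 by (auto intro!: derivative_eq_intros simp: power2_eq_square)
    also have "(exp (- (1 / t)) * (1 / t\<^sup>2) * t ^ m - exp (- (1 / t)) * (real m * t ^ (m - Suc 0))) / (t ^ m * t ^ m) =
        flat (m + 2) t - real m * flat (m + 1) t"
      using 1 by (cases m) (auto simp: flat_def field_simps power2_eq_square)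
    finally have "((\<lambda>t. exp (- (1 / t)) / t ^ m) has_real_derivative
        flat (m + 2) t - real m * flat (m + 1) t) (at t)" .
    moreover have "eventually (\<lambda>y. flat m y = exp (- (1 / y)) / y ^ m) (nhds t)"
      using eventually_nhds_in_open[of "{0<..}" t] 1
      by (auto simp: flat_def elim!: eventually_mono)
    ultimately show ?thesis
      using DERIV_cong_ev[OF refl _ refl, of "flat m"] by metis
  next
    case 2
    have "eventually (\<lambda>y. flat m y = 0) (nhds t)"
      using eventually_nhds_in_open[of "{..<0}" t] 2
      by (auto simp: flat_def elim!: eventually_mono)
    then have "(flat m has_real_derivative 0) (at t)"
      using DERIV_cong_ev[OF refl _ refl, of "flat m" "\<lambda>_. 0" t 0] by simp
    then show ?thesis using 2 by (simp add: flat_def)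
  next
    case 3
    have inv: "filterlim (\<lambda>h::real. inverse h) at_top (at_right 0)"
      by (rule filterlim_inverse_at_top_right)
    \<comment> \<open>With y = 1/h the right difference quotient at 0 is y^(m+1) / exp y.\<close>
    have lim: "((\<lambda>h::real. inverse h ^ (m + 1) / exp (inverse h)) \<longlongrightarrow> 0) (at_right 0)"
      using filterlim_compose[OF tendsto_power_div_exp_0 inv] .
    have "((\<lambda>h. flat m h / h) \<longlongrightarrow> 0) (at_right 0)"
    proof (rule Lim_transform_eventually[OF lim])
      show "\<forall>\<^sub>F h in at_right 0. inverse h ^ (m + 1) / exp (inverse h) = flat m h / h"
        using eventually_at_right_less[of 0]
        by eventually_elim (simp add: flat_def exp_minus field_simps)
    qed
    moreover have "((\<lambda>h. flat m h / h) \<longlongrightarrow> 0) (at_left 0)"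
    proof (rule Lim_transform_eventually[OF tendsto_const])
      show "\<forall>\<^sub>F h in at_left 0. 0 = flat m h / h"
        by (auto simp: eventually_at_left_field flat_def intro!: exI[of _ "-1"])
    qed
    ultimately have "((\<lambda>h. flat m h / h) \<longlongrightarrow> 0) (at 0)"
      using filterlim_at_split by blast
    then show ?thesis using 3 by (simp add: DERIV_def flat_def)
  qed
qed

text \<open>A class of functions that is closed under partial derivatives, hence consists of smooth functions,
  and is rich enough to contain the bump functions \<open>1 - exp (- k * \<psi>)\<close> for products \<open>\<psi>\<close> of \<open>flat\<close>.\<close>

inductive_set bump_algebra :: "(real ^ 'n::finite \<Rightarrow> complex) set" where
  const: "(\<lambda>x. c) \<in> bump_algebra"
| flat: "(\<lambda>x. of_real (flat m (s * x $ i + c))) \<in> bump_algebra"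
| add: "f \<in> bump_algebra \<Longrightarrow> g \<in> bump_algebra \<Longrightarrow> (\<lambda>x. f x + g x) \<in> bump_algebra"
| mult: "f \<in> bump_algebra \<Longrightarrow> g \<in> bump_algebra \<Longrightarrow> (\<lambda>x. f x * g x) \<in> bump_algebra"
| exp: "f \<in> bump_algebra \<Longrightarrow> (\<lambda>x. exp (f x)) \<in> bump_algebra"

lemma bump_algebra_prod:
  assumes "finite I" "\<And>i. i \<in> I \<Longrightarrow> f i \<in> bump_algebra"
  shows "(\<lambda>x. \<Prod>i\<in>I. f i x) \<in> bump_algebra"
  using assms by (induction I rule: finite_induct) (auto intro: bump_algebra.intros)

text \<open>A full Frechet derivative is carried through the induction, because
  \<open>partial_deriv\<close> is read off from it; membership of the directional derivatives then
  allows iteration to every order.\<close>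

lemma bump_algebra_derivative:
  assumes "f \<in> bump_algebra"
  shows "\<exists>D. (\<forall>x. (f has_derivative D x) (at x)) \<and> (\<forall>j. (\<lambda>x. D x (axis j 1)) \<in> bump_algebra)"
  using assms
proof induction
  case (const c)
  show ?case by (rule exI[of _ "\<lambda>x y. 0"]) (auto intro: bump_algebra.intros)
next
  case (flat m s i c)
  let ?d = "\<lambda>t. flat (m + 2) t - real m * flat (m + 1) t"
  let ?D = "\<lambda>x y::real^'a. complex_of_real (?d (s * x $ i + c) * (s * y $ i))"
  have "((\<lambda>x. complex_of_real (flat m (s * x $ i + c))) has_derivative ?D x) (at x)" for x
  proof -
    have "((\<lambda>x::real^'a. s * x $ i + c) has_derivative (\<lambda>y. s * y $ i)) (at x)"
      by (auto intro!: derivative_eq_intros bounded_linear_imp_has_derivative[OF bounded_linear_vec_nth])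
    from has_derivative_compose[OF this flat_has_derivative[unfolded has_field_derivative_def]]
    have "((\<lambda>x. flat m (s * x $ i + c)) has_derivative
       (\<lambda>y. ?d (s * x $ i + c) * (s * y $ i))) (at x)" .
    from has_derivative_of_real[OF this] show ?thesis .
  qed
  moreover have "(\<lambda>x. ?D x (axis j 1)) \<in> bump_algebra" for j
  proof -
    have "(\<lambda>x. ?D x (axis j 1)) =
      (\<lambda>x. complex_of_real (s * axis j 1 $ i) * (of_real (flat (m + 2) (s * x $ i + c)) +
          of_real (- real m) * of_real (flat (m + 1) (s * x $ i + c))))"
      by (auto simp: algebra_simps)
    also have "\<dots> \<in> bump_algebra"
      by (intro bump_algebra.intros)
    finally show ?thesis .
  qed
  ultimately show ?case by (intro exI[of _ ?D]) blast
next
  case (add f g)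
  then obtain D E where "\<And>x. (f has_derivative D x) (at x)" "\<And>j. (\<lambda>x. D x (axis j 1)) \<in> bump_algebra"
    "\<And>x. (g has_derivative E x) (at x)" "\<And>j. (\<lambda>x. E x (axis j 1)) \<in> bump_algebra" by metis
  then show ?case
    by (intro exI[of _ "\<lambda>x y. D x y + E x y"]) (auto intro!: derivative_intros bump_algebra.intros)
next
  case (mult f g)
  then obtain D E where "\<And>x. (f has_derivative D x) (at x)" "\<And>j. (\<lambda>x. D x (axis j 1)) \<in> bump_algebra"
    "\<And>x. (g has_derivative E x) (at x)" "\<And>j. (\<lambda>x. E x (axis j 1)) \<in> bump_algebra" by metis
  with mult.hyps show ?case
    by (intro exI[of _ "\<lambda>x y. f x * E x y + D x y * g x"])
      (auto intro!: has_derivative_mult bump_algebra.intros)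
next
  case (exp f)
  then obtain D where D: "\<And>x. (f has_derivative D x) (at x)"
    "\<And>j. (\<lambda>x. D x (axis j 1)) \<in> bump_algebra" by metis
  have "((\<lambda>x. exp (f x)) has_derivative (\<lambda>y. exp (f x) * D x y)) (at x)" for x
    using has_derivative_compose[OF D(1)[of x] DERIV_exp[of "f x", unfolded has_field_derivative_def]] .
  with D exp.hyps show ?case
    by (intro exI[of _ "\<lambda>x y. exp (f x) * D x y"]) (auto intro!: bump_algebra.intros)
qed

lemma bump_algebra_smooth:
  assumes "f \<in> bump_algebra"
  shows "smooth f"
proof -
  have diff: "g differentiable (at x)" if "g \<in> bump_algebra" for g :: "real^'n \<Rightarrow> complex" and x
    using bump_algebra_derivative[OF that] unfolding differentiable_def by blast
  have pd: "partial_deriv i g \<in> bump_algebra" if g: "g \<in> bump_algebra" for g :: "real^'n \<Rightarrow> complex" and i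
  proof -
    obtain D where D: "\<And>x. (g has_derivative D x) (at x)"
      "\<And>j. (\<lambda>x. D x (axis j 1)) \<in> bump_algebra"
      using bump_algebra_derivative[OF g] by blast
    have "partial_deriv i g = (\<lambda>x. D x (axis i 1))"
      unfolding partial_deriv_def using frechet_derivative_at[OF D(1)] by force
    with D(2) show ?thesis by simp
  qed
  have "foldr partial_deriv is f \<in> bump_algebra" for "is"
    by (induction "is") (auto simp: assms pd)
  then show ?thesis unfolding smooth_def using diff by blast
qed

text \<open>A product of \<open>flat 0\<close> factors is positive exactly on the open box, so 1 -
  exp(-k \<psi>) tends to 1 there and is 0 elsewhere. The bound by 1 and the common support prepare
  dominated convergence.\<close>

lemma test_fun_tendsto_indicator_box:
  fixes c d :: "real ^ 'n::finite"
  assumes sub: "cbox c d \<subseteq> U"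
  obtains \<phi> where "\<And>k::nat. test_fun U (\<phi> k)" "\<And>k x. norm (\<phi> k x) \<le> 1"
    "\<And>x. (\<lambda>k. \<phi> k x) \<longlonglongrightarrow> indicator (box c d) x"
    "\<And>k x. x \<notin> box c d \<Longrightarrow> \<phi> k x = 0" "\<And>k. \<phi> k \<in> borel_measurable borel"
proof -
  \<comment> \<open>The forms \<open>1 * x $ i + - c $ i\<close> and
    \<open>-1 * x $ i + d $ i\<close> match the affine argument in the rule
    \<open>bump_algebra.flat\<close>.\<close>
  define \<psi> :: "real^'n \<Rightarrow> real" where "\<psi> x = (\<Prod>i\<in>UNIV. flat 0 (1 * x $ i + - c $ i) * flat 0 (-1 * x $ i + d $ i))" for x
  define \<phi> :: "nat \<Rightarrow> real^'n \<Rightarrow> complex" where "\<phi> k x = 1 + (-1) * exp (of_real (- real k) * of_real (\<psi> x))" for k x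
  have mem: "\<phi> k \<in> bump_algebra" for k
    unfolding \<phi>_def \<psi>_def of_real_prod of_real_mult
    by (intro bump_algebra.intros bump_algebra_prod) auto
  have nn: "\<psi> x \<ge> 0" for x unfolding \<psi>_def by (intro prod_nonneg) (auto simp: flat_def)
  have zero: "\<psi> x = 0" if "x \<notin> box c d" for x
    using that unfolding \<psi>_def by (auto simp: mem_box_cart flat_def intro!: prod_zero) 
  have pos: "\<psi> x > 0" if "x \<in> box c d" for x
    using that unfolding \<psi>_def by (intro prod_pos) (auto simp: mem_box_cart flat_def)
  have eq: "\<phi> k x = of_real (1 - exp (- (real k * \<psi> x)))" for k x
    unfolding \<phi>_def by (simp add: exp_of_real[symmetric])
  have supp: "{x. \<phi> k x \<noteq> 0} \<subseteq> cbox c d" for k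
    using zero box_subset_cbox[of c d] by (force simp: eq)
  show thesis
  proof
    fix k x
    have cl: "closure {x. \<phi> k x \<noteq> 0} \<subseteq> cbox c d"
      using supp closure_minimal closed_cbox by blast
    then have "compact (closure {x. \<phi> k x \<noteq> 0})"
      by (metis compact_closure bounded_cbox bounded_subset supp)
    then show "test_fun U (\<phi> k)"
      unfolding test_fun_def using bump_algebra_smooth[OF mem] cl sub by blast
    show "norm (\<phi> k x) \<le> 1"
      using mult_nonneg_nonneg[OF of_nat_0_le_iff nn[of x], of k] unfolding eq norm_of_real by (simp add: abs_if)
    show "(\<lambda>k. \<phi> k x) \<longlonglongrightarrow> indicator (box c d) x"
    proof (cases "x \<in> box c d")
      case True
      have "(\<lambda>k. 1 - exp (- (real k * \<psi> x))) \<longlonglongrightarrow> 1 - 0"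
        using pos[OF True]
        by (intro tendsto_intros filterlim_compose[OF exp_at_bot] filterlim_compose[OF filterlim_uminus_at_bot_at_top]
          filterlim_at_top_mult_tendsto_pos[OF tendsto_const _ filterlim_real_sequentially]) auto
      from tendsto_of_real[OF this, where 'a=complex] show ?thesis using True unfolding eq by simp
    qed (simp add: eq zero)
    show "\<phi> k x = 0" if "x \<notin> box c d" using that by (simp add: eq zero)
    have "\<phi> k differentiable (at y)" for y
      using bump_algebra_derivative[OF mem] unfolding differentiable_def by blast
    then show "\<phi> k \<in> borel_measurable borel"
      by (intro borel_measurable_continuous_onI) (auto simp: continuous_on_eq_continuous_at differentiable_imp_continuous_within)
  qed
qed

subsection \<open>Uniqueness of weak derivatives\<close>

text \<open>Open boxes form an intersection stable generator of the Borel sets, so the integral of h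
  over every Borel set vanishes by a Dynkin argument, and over every Lebesgue set after discarding a
  null set. A density whose set integrals all vanish is zero almost everywhere.\<close>

lemma AE_zero_if_box_integrals_zero:
  fixes h :: "'a::euclidean_space \<Rightarrow> complex"
  assumes h: "integrable lebesgue h"
    and zero: "\<And>c d. (\<integral>x\<in>box c d. h x \<partial>lebesgue) = 0"
  shows "AE x in lebesgue. h x = 0"
proof (rule sigma_finite_measure.density_zero[OF _ h])
  obtain A :: "'a set set" where A: "countable A" "A \<subseteq> sets lborel" "\<Union>A = space lborel" "\<forall>a\<in>A. emeasure lborel a \<noteq> \<infinity>"
    using sigma_finite_measure.sigma_finite_countable[OF sigma_finite_lborel] by blast
  show "sigma_finite_measure (lebesgue :: 'a measure)"
    by unfold_locales (use A in \<open>auto intro!: exI[of _ A]\<close>)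
next
  have set_int: "set_integrable lebesgue A h" if "A \<in> sets lebesgue" for A
    using h that unfolding set_integrable_def by (rule integrable_mult_indicator[rotated])
  \<comment> \<open>The complement step of the Dynkin argument needs the integral over the whole
    space, which is a limit over growing cubes.\<close>
  have total: "(\<integral>x. h x \<partial>lebesgue) = 0"
  proof -
    let ?c = "\<lambda>k. - (real k *\<^sub>R One) :: 'a"
    let ?d = "\<lambda>k. real k *\<^sub>R One :: 'a"
    have "(\<lambda>k. \<integral>x\<in>box (?c k) (?d k). h x \<partial>lebesgue) \<longlonglongrightarrow> (\<integral>x\<in>(\<Union>k. box (?c k) (?d k)). h x \<partial>lebesgue)"
    proof (rule set_integral_cont_up)
      show "incseq (\<lambda>k. box (?c k) (?d k))"
        by (intro monoI subset_box_imp) (auto simp: inner_diff_left algebra_simps)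
      show "set_integrable lebesgue (\<Union>k. box (?c k) (?d k)) h"
        by (intro set_int) auto
    qed auto
    moreover have "(\<Union>k. box (?c k) (?d k)) = UNIV"
      using UN_box_eq_UNIV by simp
    ultimately show ?thesis
      by (simp only: zero LIMSEQ_const_iff) (simp add: set_lebesgue_integral_def)
  qed
  have borel: "(\<integral>x\<in>A. h x \<partial>lebesgue) = 0" if "A \<in> sets borel" for A
  proof -
    let ?G = "range (\<lambda>(c, d). box c d :: 'a set)"
    have "Int_stable ?G"
      by (auto simp: Int_stable_def Int_interval box_Int_box)
    moreover have "?G \<subseteq> Pow UNIV" by simp
    moreover have "A \<in> sigma_sets UNIV ?G"
      using that unfolding borel_eq_box by (simp add: sets_measure_of_conv)
    ultimately show ?thesis
    proof (induction rule: sigma_sets_induct_disjoint)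
      case (compl A)
      then have "A \<in> sets borel" unfolding borel_eq_box by (simp add: sets_measure_of_conv)
      then have A: "A \<in> sets lebesgue" by simp
      have "(\<integral>x\<in>UNIV. h x \<partial>lebesgue) = (\<integral>x\<in>A. h x \<partial>lebesgue) + (\<integral>x\<in>UNIV - A. h x \<partial>lebesgue)"
        using A by (subst set_integral_Un[symmetric]) (auto intro!: set_int arg_cong2[where f="\<lambda>A. set_lebesgue_integral lebesgue A"] sets.Diff)
      with compl total show ?case by (simp add: set_lebesgue_integral_def)
    next
      case (union A)
      then have "\<And>i. A i \<in> sets borel" unfolding borel_eq_box by (auto simp: sets_measure_of_conv)
      then have A: "\<And>i. A i \<in> sets lebesgue" by simp
      have "(\<integral>x\<in>(\<Union>i. A i). h x \<partial>lebesgue) = (\<Sum>i. (\<integral>x\<in>A i. h x \<partial>lebesgue))"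
        using A union.hyps(1)
        by (intro lebesgue_integral_countable_add set_int) (auto simp: disjoint_family_on_def)
      with union show ?case by simp
    next
      case (basic A) then show ?case using zero by auto
    qed (simp add: set_lebesgue_integral_def)
  qed
  fix A :: "'a set" assume A: "A \<in> sets lebesgue"
  \<comment> \<open>A Lebesgue set is a Borel set up to a subset of a null set.\<close>
  then obtain S N N' where SN: "S \<in> sets borel" "N' \<in> null_sets lborel" "N \<subseteq> N'" "A = S \<union> N"
    by (auto elim!: sets_completionE)
  have "(\<integral>x\<in>A. h x \<partial>lebesgue) = (\<integral>x\<in>S. h x \<partial>lebesgue)"
    unfolding set_lebesgue_integral_def
  proof (rule integral_cong_AE)
    show "AE x in lebesgue. indicator A x *\<^sub>R h x = indicator S x *\<^sub>R h x"
      using AE_not_in[OF null_sets_completionI[OF SN(2)]] by eventually_elim (use SN(3,4) in \<open>auto simp: indicator_def\<close>)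
  qed (use h A SN(1) in \<open>auto intro!: borel_measurable_scaleR borel_measurable_indicator dest: borel_measurable_integrable\<close>)
  with borel[OF SN(1)] show "(\<integral>x\<in>A. h x \<partial>lebesgue) = 0" by simp
qed

text \<open>The fundamental lemma of the calculus of variations. As g is only locally integrable, it
  is cut off to an open box with \<open>cbox c d\<close> inside U; the box integrals of the cut-off
  function are limits of integrals against test functions, hence zero.\<close>

lemma AE_zero_if_test_integrals_zero:
  fixes g :: "real ^ 'n::finite \<Rightarrow> complex"
  assumes U: "open U" and g: "locally_integrable U g"
    and zero: "\<And>\<phi>. test_fun U \<phi> \<Longrightarrow> (\<integral>x. g x * \<phi> x \<partial>lebesgue_on U) = 0"
  shows "AE x in lebesgue_on U. g x = 0"
proof -
  have Um: "U \<in> sets lebesgue" using U by auto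
  have local: "AE x in lebesgue. x \<in> box c d \<longrightarrow> g x = 0" if sub: "cbox c d \<subseteq> U" for c d
  proof -
    let ?h = "\<lambda>x. indicator (box c d) x *\<^sub>R g x"
    have "integrable (lebesgue_on (cbox c d)) g"
      using g sub unfolding locally_integrable_def by auto
    then have int: "set_integrable lebesgue (cbox c d) g"
      by (simp add: integrable_restrict_space set_integrable_def)
    have h: "integrable lebesgue ?h"
      using set_integrable_subset[OF int, of "box c d"] box_subset_cbox[of c d] by (simp add: set_integrable_def)
    have "AE x in lebesgue. ?h x = 0"
    proof (rule AE_zero_if_box_integrals_zero[OF h])
      fix c' d' :: "real^'n"
      \<comment> \<open>An empty intersection could be described by corners whose closed box is not
        inside \<open>cbox c d\<close>; the corners 1 and 0 make both the open and the closed box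
        empty.\<close>
      obtain c'' d'' where eq: "box c d \<inter> box c' d' = box c'' d''" and sub'': "cbox c'' d'' \<subseteq> cbox c d"
      proof (cases "box c d \<inter> box c' d' = {}")
        case True
        have e: "box 1 (0::real^'n) = {}" "cbox 1 (0::real^'n) = {}" 
          by (auto simp: interval_eq_empty_cart)
        show thesis by (rule that[of 1 0]) (simp_all add: True e)
      next
        case False
        obtain p q where "box c d \<inter> box c' d' = box p q" using box_Int_box[of c d c' d'] by blast
        with False show thesis
          using closure_mono[of "box p q" "box c d"] closure_box[of p q] closure_box[of c d]
          by (intro that[of p q]) (auto simp del: closure_box)
      qed
      from sub'' sub have "cbox c'' d'' \<subseteq> U" by blast
      then obtain \<phi> where \<phi>: "\<And>k::nat. test_fun U (\<phi> k)" "\<And>k x. norm (\<phi> k x) \<le> 1"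
        "\<And>x. (\<lambda>k. \<phi> k x) \<longlonglongrightarrow> indicator (box c'' d'') x"
        "\<And>k x. x \<notin> box c'' d'' \<Longrightarrow> \<phi> k x = 0"
        "\<And>k. \<phi> k \<in> borel_measurable borel"
        using test_fun_tendsto_indicator_box by metis
      have "(\<integral>x\<in>box c' d'. ?h x \<partial>lebesgue) = (\<integral>x. indicator (box c'' d'') x * ?h x \<partial>lebesgue)"
        unfolding set_lebesgue_integral_def using eq
        by (intro Bochner_Integration.integral_cong) (auto simp: indicator_def)
      moreover have "(\<lambda>k. \<integral>x. \<phi> k x * ?h x \<partial>lebesgue) \<longlonglongrightarrow> (\<integral>x. indicator (box c'' d'') x * ?h x \<partial>lebesgue)"
      proof (rule integral_dominated_convergence[where w="\<lambda>x. norm (?h x)"])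
        show "AE x in lebesgue. (\<lambda>k. \<phi> k x * ?h x) \<longlonglongrightarrow> indicator (box c'' d'') x * ?h x"
          by (intro AE_I2 tendsto_mult \<phi> tendsto_const)
        show "AE x in lebesgue. norm (\<phi> k x * ?h x) \<le> norm (?h x)" for k
          by (intro AE_I2) (metis \<phi>(2) norm_mult norm_ge_zero mult_left_le_one_le)
        show "(\<lambda>x. \<phi> k x * ?h x) \<in> borel_measurable lebesgue" for k
          using \<phi>(5)[of k] by (intro borel_measurable_times borel_measurable_integrable[OF h] measurable_completion) auto
        show "(\<lambda>x. indicator (box c'' d'') x * ?h x) \<in> borel_measurable lebesgue"
          using borel_measurable_LIMSEQ_metric[OF \<phi>(5) \<phi>(3)]
          by (intro borel_measurable_times borel_measurable_integrable[OF h] measurable_completion) auto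
      qed (rule integrable_norm[OF h])
      moreover have "(\<integral>x. \<phi> k x * ?h x \<partial>lebesgue) = 0" for k
      proof -
        have "(\<integral>x. \<phi> k x * ?h x \<partial>lebesgue) = (\<integral>x. indicator U x *\<^sub>R (g x * \<phi> k x) \<partial>lebesgue)"
        proof (rule Bochner_Integration.integral_cong[OF refl])
          fix x
          have "x \<in> U" if "x \<in> box c d" using that box_subset_cbox sub by blast
          then show "\<phi> k x * ?h x = indicator U x *\<^sub>R (g x * \<phi> k x)"
            using \<phi>(4)[of x k] eq by (auto simp: indicator_def)
        qed
        also have "\<dots> = (\<integral>x. g x * \<phi> k x \<partial>lebesgue_on U)"
          using Um by (simp add: integral_restrict_space)
        finally show ?thesis using zero[OF \<phi>(1)] by simp
      qed
      ultimately show "(\<integral>x\<in>box c' d'. ?h x \<partial>lebesgue) = 0"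
        by (simp add: LIMSEQ_const_iff)
    qed
    then show ?thesis by eventually_elim (auto simp: indicator_def split: if_splits)
  qed
  \<comment> \<open>Countably many closed boxes exhaust U and their faces are null sets, so the
    local statement on open boxes suffices.\<close>
  obtain \<D> where \<D>: "countable \<D>" "\<And>X. X \<in> \<D> \<Longrightarrow> X \<subseteq> U"
     "\<And>X. X \<in> \<D> \<Longrightarrow> \<exists>c d. X = cbox c d" "\<Union>\<D> = U"
    by (rule open_countable_Union_open_cbox[OF U]) blast
  have "AE x in lebesgue. \<forall>X\<in>\<D>. x \<in> X \<longrightarrow> g x = 0"
  proof (rule AE_ball_countable'[OF _ \<D>(1)])
    fix X assume X: "X \<in> \<D>"
    then obtain c d where X': "X = cbox c d" using \<D>(3) by blast
    have "cbox c d - box c d \<in> null_sets lebesgue"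
      using negligible_frontier_interval negligible_iff_null_sets by blast
    from AE_not_in[OF this] local[OF \<D>(2)[OF X, unfolded X']]
    show "AE x in lebesgue. x \<in> X \<longrightarrow> g x = 0"
      unfolding X' by eventually_elim blast
  qed
  then have "AE x in lebesgue. x \<in> U \<longrightarrow> g x = 0"
    unfolding \<D>(4)[symmetric] by eventually_elim blast
  then show ?thesis using Um by (simp add: AE_restrict_space_iff)
qed

subsection \<open>Integration by parts on a box\<close>

text \<open>Shifting the box by \<open>h\<close> in direction \<open>i\<close> removes a slab at one face and adds a slab at the opposite
  one. If \<open>F\<close> agrees on the two slabs, the integral of the shift difference vanishes; letting \<open>h\<close> tend
  to \<open>0\<close> gives the divergence theorem below without iterated integrals.\<close>

lemma integral_shift_difference_box:
  fixes F :: "real ^ 'n::finite \<Rightarrow> complex" and a b :: "real ^ 'n"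
  defines "L \<equiv> \<lambda>i. b $ i - a $ i"
  assumes cont: "continuous_on UNIV F"
    and ab: "a $ i < b $ i"
    and per: "\<And>x. x \<in> cbox a b \<Longrightarrow> x $ i \<le> a $ i + h \<Longrightarrow> F (x + L i *\<^sub>R axis i 1) = F x"
    and h: "0 < h" "h < L i"
  shows "integral (cbox a b) (\<lambda>x. F (x + h *\<^sub>R axis i 1) - F x) = 0"
proof -
  let ?e = "axis i (1::real)"
  let ?b' = "b + h *\<^sub>R ?e"
  have e: "?e \<in> Basis" by simp
  have int: "F integrable_on cbox c d" for c d
    by (intro integrable_continuous continuous_on_subset[OF cont]) auto
  have ax: "x \<bullet> ?e = x $ i" for x :: "real^'n" by (simp add: inner_axis)
  \<comment> \<open>\<open>cbox a c1\<close> is the slab of width h inside the lower face and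
    \<open>cbox c2 ?b'\<close> the slab of width h beyond the upper one; translation by the side
    length maps the first onto the second.\<close>
  define c1 where "c1 = (\<chi> j. if j = i then a $ i + h else b $ j)"
  define c2 where "c2 = (\<chi> j. if j = i then b $ i else a $ j)"
  have mem: "x \<in> cbox p q \<longleftrightarrow> (p $ i \<le> x $ i \<and> x $ i \<le> q $ i) \<and> (\<forall>j. j \<noteq> i \<longrightarrow> p $ j \<le> x $ j \<and> x $ j \<le> q $ j)"
    for x p q :: "real^'n" unfolding mem_box_cart by metis
  \<comment> \<open>The elongated box \<open>cbox a ?b'\<close> is cut in two ways, at
    \<open>a $ i + h\<close> and at \<open>b $ i\<close>; once the slab integrals cancel, the
    integrals over the shifted and the original box agree.\<close>
  have s1: "cbox a ?b' \<inter> {x. x \<bullet> ?e \<le> a $ i + h} = cbox a c1"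
    and s2: "cbox a ?b' \<inter> {x. x \<bullet> ?e \<ge> a $ i + h} = cbox (a + h *\<^sub>R ?e) ?b'"
    and s3: "cbox a ?b' \<inter> {x. x \<bullet> ?e \<le> b $ i} = cbox a b"
    and s4: "cbox a ?b' \<inter> {x. x \<bullet> ?e \<ge> b $ i} = cbox c2 ?b'"
    using h ab unfolding ax
    by (auto simp: mem c1_def c2_def L_def axis_def)
  have shift: "a + L i *\<^sub>R ?e = c2" "c1 + L i *\<^sub>R ?e = ?b'"
    by (auto simp: vec_eq_iff c1_def c2_def L_def axis_def)
  have sub: "x \<in> cbox a b \<and> x $ i \<le> a $ i + h" if "x \<in> cbox a c1" for x
    using that h ab by (auto simp: mem c1_def L_def)
  have "integral (cbox c2 ?b') F = integral (cbox a c1) (F \<circ> (+) (L i *\<^sub>R ?e))"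
    unfolding integral_shift_cbox_plus shift ..
  also have "\<dots> = integral (cbox a c1) F"
    by (intro integral_cong) (use per sub in \<open>auto simp: add.commute\<close>)
  finally have slab: "integral (cbox c2 ?b') F = integral (cbox a c1) F" .
  have "integral (cbox a b) (\<lambda>x. F (x + h *\<^sub>R ?e)) = integral (cbox (a + h *\<^sub>R ?e) ?b') F"
    using integral_shift_cbox_plus[of a b F "h *\<^sub>R ?e"] by (simp add: o_def add.commute)
  also have "\<dots> = integral (cbox a b) F"
    using integral_split[OF int e, of a ?b' "a $ i + h"] integral_split[OF int e, of a ?b' "b $ i"]
    unfolding s1 s2 s3 s4 slab by simp
  finally show ?thesis
    by (subst integral_diff)
      (auto intro!: integrable_continuous continuous_on_compose2[OF cont] continuous_intros)
qed

lemma has_vector_derivative_along_line: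
  fixes x e :: "'a::real_normed_vector"
  assumes "(F has_derivative D) (at (x + t *\<^sub>R e))"
  shows "((\<lambda>t. F (x + t *\<^sub>R e)) has_vector_derivative D e) (at t)"
proof -
  have "((\<lambda>t. x + t *\<^sub>R e) has_derivative (\<lambda>s. s *\<^sub>R e)) (at t)"
    by (auto intro!: derivative_eq_intros)
  from has_derivative_compose[OF this assms] show ?thesis
    unfolding has_vector_derivative_def linear_scale[OF has_derivative_linear[OF assms]] .
qed

text \<open>The mean value inequality along a segment; it supplies the dominating constant for the
  difference quotients in the next lemma.\<close>

lemma norm_shift_difference_le:
  fixes F :: "'a::real_normed_vector \<Rightarrow> 'b::real_inner"
  assumes D: "\<And>x. (F has_derivative F' x) (at x)"
    and B: "\<And>t. t \<in> {0..h} \<Longrightarrow> norm (F' (x + t *\<^sub>R e) e) \<le> B"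
    and h: "0 < h"
  shows "norm (F (x + h *\<^sub>R e) - F x) \<le> h * B"
proof -
  note der = has_vector_derivative_along_line[where x=x and e=e, OF D]
  have "\<exists>t\<in>{0<..<h}. norm (F (x + h *\<^sub>R e) - F (x + 0 *\<^sub>R e)) \<le> norm ((h - 0) *\<^sub>R F' (x + t *\<^sub>R e) e)"
  proof (rule mvt_general[OF h])
    show "continuous_on {0..h} (\<lambda>t. F (x + t *\<^sub>R e))"
      by (intro continuous_at_imp_continuous_on ballI has_vector_derivative_continuous[OF der])
  qed (rule der[unfolded has_vector_derivative_def])
  then obtain t where "t \<in> {0<..<h}"
    "norm (F (x + h *\<^sub>R e) - F (x + 0 *\<^sub>R e)) \<le> norm ((h - 0) *\<^sub>R F' (x + t *\<^sub>R e) e)" ..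
  moreover have "norm ((h - 0) *\<^sub>R F' (x + t *\<^sub>R e) e) \<le> h * B"
    using mult_left_mono[OF B[of t], of h] h \<open>t \<in> {0<..<h}\<close> by simp
  ultimately have "norm (F (x + h *\<^sub>R e) - F (x + 0 *\<^sub>R e)) \<le> h * B" by linarith
  then show ?thesis by simp
qed

text \<open>Difference quotients have integral zero over the box and converge dominatedly to the
  partial derivative. The hypothesis \<open>per\<close> is the common form of both boundary
  conditions: F is periodic, or F vanishes in a collar at the lower face and beyond the upper
  face.\<close>

lemma integral_partial_box_eq_0:
  fixes F :: "real ^ 'n::finite \<Rightarrow> complex" and a b :: "real ^ 'n"
  assumes D: "\<And>x. (F has_derivative F' x) (at x)"
    and cont: "continuous_on UNIV (\<lambda>x. F' x (axis i 1))"
    and box: "box a b \<noteq> {}"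
    and \<delta>: "0 < \<delta>"
    and per: "\<And>x. x \<in> cbox a b \<Longrightarrow> x $ i \<le> a $ i + \<delta> \<Longrightarrow> F (x + (b $ i - a $ i) *\<^sub>R axis i 1) = F x"
  shows "(\<integral>x. F' x (axis i 1) \<partial>lebesgue_on (box a b)) = 0"
proof -
  let ?e = "axis i (1::real)"
  let ?G = "\<lambda>x. F' x (axis i 1)"
  have ab: "a $ i < b $ i" using box by (auto simp: interval_eq_empty_cart not_le)
  have contF: "continuous_on UNIV F"
    using D by (auto simp: continuous_on_eq_continuous_at intro: has_derivative_continuous)
  \<comment> \<open>Half the minimum keeps every shift strictly below both \<delta> and the side
    length.\<close>
  define r where "r = min \<delta> (b $ i - a $ i) / 2"
  have r: "0 < r" "r < \<delta>" "r < b $ i - a $ i" using \<delta> ab by (auto simp: r_def min_def)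
  define h where "h k = r / real (Suc k)" for k
  have h: "0 < h k" "h k \<le> r" for k using r by (auto simp: h_def field_simps)
  have hlim: "h \<longlonglongrightarrow> 0"
    unfolding h_def by (rule LIMSEQ_Suc[OF lim_const_over_n])
  \<comment> \<open>Shifted points may leave the box, so the derivative is bounded on the box
    elongated by r.\<close>
  obtain B where B: "\<And>x. x \<in> cbox a (b + r *\<^sub>R ?e) \<Longrightarrow> norm (?G x) \<le> B"
  proof -
    have "bounded (?G ` cbox a (b + r *\<^sub>R ?e))"
      by (intro compact_imp_bounded compact_continuous_image continuous_on_subset[OF cont]) auto
    then show thesis using that unfolding bounded_iff by blast
  qed
  define q where "q k x = (F (x + h k *\<^sub>R ?e) - F x) /\<^sub>R h k" for k x
  have "(\<lambda>k. integral (cbox a b) (q k)) \<longlonglongrightarrow> integral (cbox a b) ?G"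
  proof (rule dominated_convergence)
    show "q k integrable_on cbox a b" for k
      unfolding q_def by (auto intro!: integrable_continuous continuous_on_compose2[OF contF] continuous_intros)
    show "norm (q k x) \<le> B" if x: "x \<in> cbox a b" for k x
    proof -
      have "norm (?G (x + t *\<^sub>R ?e)) \<le> B" if "t \<in> {0..h k}" for t
      proof (rule B)
        have "t \<le> r" using that h(2)[of k] by auto
        then show "x + t *\<^sub>R ?e \<in> cbox a (b + r *\<^sub>R ?e)"
          using x that by (auto simp: mem_box_cart axis_def intro: add_mono add_increasing2)
      qed
      from norm_shift_difference_le[OF D this] have "norm (F (x + h k *\<^sub>R ?e) - F x) \<le> h k * B"
        using h(1)[of k] by simp
      then show ?thesis unfolding q_def norm_scaleR using h(1)[of k]
        by (simp add: divide_inverse_commute[symmetric] pos_divide_le_eq mult.commute)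
    qed
    show "(\<lambda>k. q k x) \<longlonglongrightarrow> ?G x" for x
    proof -
      have "((\<lambda>t. F (x + t *\<^sub>R ?e)) has_vector_derivative ?G x) (at 0)"
        by (rule has_vector_derivative_along_line) (use D[of x] in simp)
      then have "((\<lambda>t. (F (x + t *\<^sub>R ?e) - F x) /\<^sub>R t) \<longlongrightarrow> ?G x) (at 0)"
        by (simp add: has_vector_derivative_complex_iff DERIV_def tendsto_complex_iff divide_inverse_commute)
      moreover have "filterlim h (at 0) sequentially"
        by (rule filterlim_atI[OF hlim], intro always_eventually allI)
          (use h(1) in \<open>simp add: order_less_imp_not_eq2\<close>)
      ultimately show ?thesis unfolding q_def by (rule filterlim_compose)
    qed
  qed auto
  moreover have "integral (cbox a b) (q k) = 0" for k
    using integral_shift_difference_box[OF contF ab per, of "h k"] h[of k] r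
    unfolding q_def by simp
  ultimately have "integral (cbox a b) ?G = 0" by (simp add: LIMSEQ_const_iff)
  moreover have "set_integrable lebesgue (box a b) ?G"
    by (rule set_integrable_subset[OF absolutely_integrable_continuous[OF continuous_on_subset[OF cont], of a b]])
      (auto intro: box_subset_cbox[THEN subsetD])
  then have "integrable (lebesgue_on (box a b)) ?G"
    by (simp add: integrable_restrict_space set_integrable_def)
  ultimately show ?thesis
    by (simp add: lebesgue_integral_eq_integral integral_open_interval)
qed

subsection \<open>Almost everywhere equality and square integrable functions\<close>

text \<open>Lebesgue measure is complete, so preimages under the two functions, which differ by a
  null set, are measurable together.\<close>

lemma borel_measurable_lebesgue_on_cong_AE:
  fixes f g :: "'a::euclidean_space \<Rightarrow> 'b::euclidean_space"
  assumes S: "S \<in> sets lebesgue"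
    and f: "f \<in> borel_measurable (lebesgue_on S)"
    and eq: "AE x in lebesgue_on S. f x = g x"
  shows "g \<in> borel_measurable (lebesgue_on S)"
proof -
  let ?f = "\<lambda>x. if x \<in> S then f x else 0" and ?g = "\<lambda>x. if x \<in> S then g x else 0"
  have f': "?f \<in> borel_measurable lebesgue"
    using f borel_measurable_if[OF S] by blast
  have eq': "AE x in lebesgue. ?f x = ?g x"
    using eq S by (simp add: AE_restrict_space_iff)
  have "?g \<in> borel_measurable lebesgue"
  proof (rule borel_measurableI)
    fix T :: "'b set" assume "open T"
    then have "?f -` T \<inter> space lebesgue \<in> sets lebesgue"
      by (intro measurable_sets[OF f'] borel_open)
    then show "?g -` T \<inter> space lebesgue \<in> sets lebesgue"
    proof (rule completion.in_sets_AE[rotated])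
      show "AE x in lebesgue. (x \<in> ?f -` T \<inter> space lebesgue) = (x \<in> ?g -` T \<inter> space lebesgue)"
        using eq' by eventually_elim (simp only: Int_iff vimage_eq)
    qed simp
  qed
  then show ?thesis using borel_measurable_if[OF S] by blast
qed

text \<open>By completeness measurability passes between f and g, and if neither is integrable both
  integrals have the default value 0. Thus representatives can be exchanged without checking
  measurability.\<close>

lemma lebesgue_on_cong_AE:
  fixes f g :: "'a::euclidean_space \<Rightarrow> 'b::euclidean_space"
  assumes S: "S \<in> sets lebesgue"
    and eq: "AE x in lebesgue_on S. f x = g x"
  shows "integrable (lebesgue_on S) f \<longleftrightarrow> integrable (lebesgue_on S) g"
    and "(\<integral>x. f x \<partial>lebesgue_on S) = (\<integral>x. g x \<partial>lebesgue_on S)"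
proof -
  have eq': "AE x in lebesgue_on S. g x = f x" using eq by (auto elim!: eventually_mono)
  have meas: "f \<in> borel_measurable (lebesgue_on S) \<longleftrightarrow> g \<in> borel_measurable (lebesgue_on S)"
    using borel_measurable_lebesgue_on_cong_AE[OF S] eq eq' by blast
  show "integrable (lebesgue_on S) f \<longleftrightarrow> integrable (lebesgue_on S) g"
    using meas integrable_cong_AE[of f "lebesgue_on S" g, OF _ _ eq] borel_measurable_integrable by blast
  with meas show "(\<integral>x. f x \<partial>lebesgue_on S) = (\<integral>x. g x \<partial>lebesgue_on S)"
    using integral_cong_AE[of f "lebesgue_on S" g, OF _ _ eq] not_integrable_integral_eq
    borel_measurable_integrable by metis
qed

text \<open>An arbitrary measure is allowed since the product estimates, the limit lemmas and the
  energy comparison use nothing of the domain.\<close>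

definition L2fun :: "'a measure \<Rightarrow> ('a \<Rightarrow> complex) \<Rightarrow> bool" where
  "L2fun M f \<longleftrightarrow> f \<in> borel_measurable M \<and> integrable M (\<lambda>x. (norm (f x))\<^sup>2)"

lemma L2_space_iff: "f \<in> L2_space U \<longleftrightarrow> L2fun (lebesgue_on U) f"
  by (simp add: L2_space_def L2fun_def)

lemma L2fun_mult_integrable:
  assumes f: "L2fun M f" and g: "L2fun M g"
  shows "integrable M (\<lambda>x. f x * g x)"
proof (rule Bochner_Integration.integrable_bound)
  show "integrable M (\<lambda>x. (norm (f x))\<^sup>2 + (norm (g x))\<^sup>2)"
    using f g by (simp add: L2fun_def)
  show "AE x in M. norm (f x * g x) \<le> norm ((norm (f x))\<^sup>2 + (norm (g x))\<^sup>2)"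
  proof (rule AE_I2)
    fix x
    have "0 \<le> (norm (f x) - norm (g x))\<^sup>2" by simp
    then have "2 * (norm (f x) * norm (g x)) \<le> (norm (f x))\<^sup>2 + (norm (g x))\<^sup>2"
      by (simp add: power2_diff)
    moreover have "0 \<le> norm (f x) * norm (g x)" by simp
    ultimately have "norm (f x) * norm (g x) \<le> (norm (f x))\<^sup>2 + (norm (g x))\<^sup>2"
      by linarith
    then show "norm (f x * g x) \<le> norm ((norm (f x))\<^sup>2 + (norm (g x))\<^sup>2)"
      by (simp add: norm_mult)
  qed
qed (use f g in \<open>auto simp: L2fun_def\<close>)

lemma L2fun_cnj: "L2fun M f \<Longrightarrow> L2fun M (\<lambda>x. cnj (f x))"
proof -
  assume "L2fun M f"
  moreover have "cnj \<in> borel_measurable borel"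
    by (intro borel_measurable_continuous_onI continuous_intros)
  ultimately show ?thesis
    using measurable_compose[of f M borel cnj borel] by (simp add: L2fun_def)
qed

lemma L2fun_bounded_mult:
  assumes m: "m \<in> borel_measurable M" "AE x in M. norm (m x) \<le> C" and f: "L2fun M f"
  shows "L2fun M (\<lambda>x. m x * f x)"
  unfolding L2fun_def
proof
  show "(\<lambda>x. m x * f x) \<in> borel_measurable M"
    using m f by (auto simp: L2fun_def)
  show "integrable M (\<lambda>x. (norm (m x * f x))\<^sup>2)"
  proof (rule Bochner_Integration.integrable_bound)
    show "integrable M (\<lambda>x. C\<^sup>2 * (norm (f x))\<^sup>2)" using f by (simp add: L2fun_def)
    show "AE x in M. norm ((norm (m x * f x))\<^sup>2) \<le> norm (C\<^sup>2 * (norm (f x))\<^sup>2)"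
      using m(2) by eventually_elim (auto simp: norm_mult power_mult_distrib intro!: mult_right_mono power_mono)
  qed (use m f in \<open>auto simp: L2fun_def\<close>)
qed

lemma L2fun_cmult: "L2fun M f \<Longrightarrow> L2fun M (\<lambda>x. c * f x)"
  by (rule L2fun_bounded_mult[where C="norm c"]) auto

lemma L2fun_add:
  assumes f: "L2fun M f" and g: "L2fun M g"
  shows "L2fun M (\<lambda>x. f x + g x)"
  unfolding L2fun_def
proof
  show "(\<lambda>x. f x + g x) \<in> borel_measurable M"
    using f g by (auto simp: L2fun_def)
  show "integrable M (\<lambda>x. (norm (f x + g x))\<^sup>2)"
  proof (rule Bochner_Integration.integrable_bound)
    show "integrable M (\<lambda>x. 2 * ((norm (f x))\<^sup>2 + (norm (g x))\<^sup>2))" using f g by (simp add: L2fun_def)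
    show "AE x in M. norm ((norm (f x + g x))\<^sup>2) \<le> norm (2 * ((norm (f x))\<^sup>2 + (norm (g x))\<^sup>2))"
    proof (rule AE_I2)
      fix x
      have "(norm (f x + g x))\<^sup>2 \<le> (norm (f x) + norm (g x))\<^sup>2"
        by (intro power_mono norm_triangle_ineq) auto
      also have "\<dots> \<le> 2 * ((norm (f x))\<^sup>2 + (norm (g x))\<^sup>2)"
        using zero_le_power2[of "norm (f x) - norm (g x)"] by (simp add: power2_eq_square algebra_simps)
      finally show "norm ((norm (f x + g x))\<^sup>2) \<le> norm (2 * ((norm (f x))\<^sup>2 + (norm (g x))\<^sup>2))" by simp
    qed
  qed (use f g in \<open>auto simp: L2fun_def\<close>)
qed

lemma L2fun_diff: "L2fun M f \<Longrightarrow> L2fun M g \<Longrightarrow> L2fun M (\<lambda>x. f x - g x)"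
  using L2fun_add[of M f "\<lambda>x. - 1 * g x"] L2fun_cmult[of M g "-1"] by simp

lemma L2fun_Cauchy_Schwarz:
  assumes f: "L2fun M f" and g: "L2fun M g"
  shows "norm (\<integral>x. f x * g x \<partial>M) \<le> sqrt (\<integral>x. (norm (f x))\<^sup>2 \<partial>M) * sqrt (\<integral>x. (norm (g x))\<^sup>2 \<partial>M)"
proof -
  let ?A = "\<integral>x. (norm (f x))\<^sup>2 \<partial>M" and ?B = "\<integral>x. (norm (g x))\<^sup>2 \<partial>M"
  let ?I = "\<integral>x. norm (f x) * norm (g x) \<partial>M"
  have int: "integrable M (\<lambda>x. norm (f x) * norm (g x))"
    using integrable_norm[OF L2fun_mult_integrable[OF f g]] by (simp add: norm_mult)
  have nn: "0 \<le> ?I" by (intro Bochner_Integration.integral_nonneg) auto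
  have "(\<integral>\<^sup>+x. ennreal (norm (f x)) * ennreal (norm (g x)) \<partial>M)\<^sup>2
     \<le> (\<integral>\<^sup>+x. ennreal (norm (f x)) ^ 2 \<partial>M) * (\<integral>\<^sup>+x. ennreal (norm (g x)) ^ 2 \<partial>M)"
    using f g by (intro Cauchy_Schwarz_nn_integral) (auto simp: L2fun_def)
  also have "(\<integral>\<^sup>+x. ennreal (norm (f x)) * ennreal (norm (g x)) \<partial>M) = ennreal ?I"
    using int by (subst nn_integral_eq_integral[symmetric]) (auto simp: ennreal_mult)
  also have "(\<integral>\<^sup>+x. ennreal (norm (f x)) ^ 2 \<partial>M) = ennreal ?A"
    using f by (subst nn_integral_eq_integral[symmetric]) (auto simp: L2fun_def ennreal_power)
  also have "(\<integral>\<^sup>+x. ennreal (norm (g x)) ^ 2 \<partial>M) = ennreal ?B"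
    using g by (subst nn_integral_eq_integral[symmetric]) (auto simp: L2fun_def ennreal_power)
  finally have "?I\<^sup>2 \<le> ?A * ?B"
    using nn by (simp add: ennreal_power ennreal_mult[symmetric] ennreal_le_iff)
  then have "?I \<le> sqrt (?A * ?B)" by (rule real_le_rsqrt)
  moreover have "norm (\<integral>x. f x * g x \<partial>M) \<le> ?I"
    using integral_norm_bound[of M "\<lambda>x. f x * g x"] by (simp add: norm_mult)
  ultimately show ?thesis by (simp add: real_sqrt_mult)
qed

text \<open>With F k = f - df and G k = g - dg the product is f g minus two mixed terms plus df dg,
  and Cauchy-Schwarz sends each term containing a difference to 0.\<close>

lemma L2fun_product_tendsto:
  assumes f: "L2fun M f" "\<And>k::nat. L2fun M (F k)"
    and g: "L2fun M g" "\<And>k::nat. L2fun M (G k)"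
    and limF: "(\<lambda>k. \<integral>x. (norm (f x - F k x))\<^sup>2 \<partial>M) \<longlonglongrightarrow> 0"
    and limG: "(\<lambda>k. \<integral>x. (norm (g x - G k x))\<^sup>2 \<partial>M) \<longlonglongrightarrow> 0"
  shows "(\<lambda>k. \<integral>x. F k x * G k x \<partial>M) \<longlonglongrightarrow> (\<integral>x. f x * g x \<partial>M)"
proof -
  let ?N = "\<lambda>h. sqrt (\<integral>x. (norm (h x))\<^sup>2 \<partial>M)"
  define df where "df k x = f x - F k x" for k x
  define dg where "dg k x = g x - G k x" for k x
  have L: "L2fun M (df k)" "L2fun M (dg k)" for k
    unfolding df_def dg_def using f g by (auto intro: L2fun_diff)
  have cs0: "(\<lambda>k. \<integral>x. p k x * q k x \<partial>M) \<longlonglongrightarrow> 0"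
    if "\<And>k. L2fun M (p k)" "\<And>k. L2fun M (q k)" "(\<lambda>k. ?N (p k) * ?N (q k)) \<longlonglongrightarrow> 0" for p q
    by (rule Lim_null_comparison[OF _ that(3)]) (intro always_eventually allI L2fun_Cauchy_Schwarz that)
  have lim: "(\<lambda>k. ?N (df k)) \<longlonglongrightarrow> 0" "(\<lambda>k. ?N (dg k)) \<longlonglongrightarrow> 0"
    using tendsto_real_sqrt[OF limF] tendsto_real_sqrt[OF limG] by (auto simp: df_def dg_def)
  have "(\<lambda>k. (\<integral>x. f x * g x \<partial>M) - (\<integral>x. df k x * g x \<partial>M) - (\<integral>x. f x * dg k x \<partial>M) + (\<integral>x. df k x * dg k x \<partial>M))
     \<longlonglongrightarrow> (\<integral>x. f x * g x \<partial>M) - 0 - 0 + 0"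
    using f g L lim by (intro tendsto_intros cs0) (auto intro!: tendsto_mult_left_zero tendsto_mult_right_zero tendsto_mult_zero)
  moreover have "(\<integral>x. F k x * G k x \<partial>M) =
     (\<integral>x. f x * g x \<partial>M) - (\<integral>x. df k x * g x \<partial>M) - (\<integral>x. f x * dg k x \<partial>M) + (\<integral>x. df k x * dg k x \<partial>M)" for k
    using f g L by (subst Bochner_Integration.integral_diff[symmetric] Bochner_Integration.integral_add[symmetric],
      auto intro!: L2fun_mult_integrable Bochner_Integration.integrable_diff)+ (simp add: df_def dg_def algebra_simps)
  ultimately show ?thesis by simp
qed

subsection \<open>Weak derivatives\<close>

lemma smooth_partial_deriv: "smooth f \<Longrightarrow> smooth (partial_deriv i f)"
  unfolding smooth_def
proof (intro allI)
  fix "is" x assume f: "\<forall>is x. foldr partial_deriv is f differentiable (at x)"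
  show "foldr partial_deriv is (partial_deriv i f) differentiable (at x)"
    \<comment> \<open>\<open>foldr\<close> applies the last list element first, so the extra
      derivative is appended at the end.\<close>
    using f[rule_format, of "is @ [i]" x] by simp
qed

lemma smooth_has_derivative:
  assumes "smooth f"
  shows "(f has_derivative frechet_derivative f (at x)) (at x)"
  using assms[unfolded smooth_def, rule_format, of "[]" x] by (simp add: frechet_derivative_works)

lemma smooth_continuous_on: "smooth f \<Longrightarrow> continuous_on S f"
  by (intro continuous_at_imp_continuous_on ballI has_derivative_continuous[OF smooth_has_derivative])

lemma partial_deriv_eq:
  assumes "(f has_derivative D) (at x)"
  shows "partial_deriv i f x = D (axis i 1)"
  using frechet_derivative_at[OF assms] by (simp add: partial_deriv_def)

lemma test_fun_partial_deriv:
  assumes "test_fun U \<phi>"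
  shows "test_fun U (partial_deriv i \<phi>)"
proof -
  have "{x. partial_deriv i \<phi> x \<noteq> 0} \<subseteq> closure {x. \<phi> x \<noteq> 0}"
  proof
    fix x assume x: "x \<in> {x. partial_deriv i \<phi> x \<noteq> 0}"
    show "x \<in> closure {x. \<phi> x \<noteq> 0}"
    proof (rule ccontr)
      assume "x \<notin> closure {x. \<phi> x \<noteq> 0}"
      then have x': "x \<in> - closure {x. \<phi> x \<noteq> 0}" by simp
      have zero: "0 = \<phi> y" if "y \<in> - closure {x. \<phi> x \<noteq> 0}" for y
        using that closure_subset[of "{x. \<phi> x \<noteq> 0}"] by force
      have "(\<phi> has_derivative (\<lambda>_. 0)) (at x)"
        by (rule has_derivative_transform_within_open[OF has_derivative_const _ x' zero])
          (simp add: open_Compl)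
      from partial_deriv_eq[OF this] x show False by simp
    qed
  qed
  then have sub: "closure {x. partial_deriv i \<phi> x \<noteq> 0} \<subseteq> closure {x. \<phi> x \<noteq> 0}"
    by (simp add: closure_minimal)
  moreover have "closed (closure {x. partial_deriv i \<phi> x \<noteq> 0})" by simp
  ultimately have "compact (closure {x. partial_deriv i \<phi> x \<noteq> 0})"
    using assms unfolding test_fun_def by (metis compact_Int_closed inf.absorb_iff2)
  with assms sub show ?thesis unfolding test_fun_def by (auto intro: smooth_partial_deriv)
qed

text \<open>On the compact support of \<phi> local integrability gives integrability, and \<phi> is
  bounded. This allows the defining identity of weak derivatives to be split linearly.\<close>

lemma integrable_mult_test_fun:
  fixes f :: "real ^ 'n::finite \<Rightarrow> complex"
  assumes U: "U \<in> sets lebesgue" and f: "locally_integrable U f" and \<phi>: "test_fun U \<phi>"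
  shows "integrable (lebesgue_on U) (\<lambda>x. f x * \<phi> x)"
proof -
  let ?K = "closure {x. \<phi> x \<noteq> 0}"
  have K: "compact ?K" "?K \<subseteq> U" and sm: "smooth \<phi>" using \<phi> by (auto simp: test_fun_def)
  have "integrable (lebesgue_on ?K) f" using f K by (auto simp: locally_integrable_def)
  then have int: "integrable lebesgue (\<lambda>x. indicator ?K x *\<^sub>R f x)"
    by (simp add: integrable_restrict_space)
  obtain B where B: "\<And>x. x \<in> ?K \<Longrightarrow> norm (\<phi> x) \<le> B"
    using compact_imp_bounded[OF compact_continuous_image[OF smooth_continuous_on[OF sm] K(1)]]
    unfolding bounded_iff by blast
  have eq: "indicator U x *\<^sub>R (f x * \<phi> x) = \<phi> x * (indicator ?K x *\<^sub>R f x)" for x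
    using K(2) closure_subset[of "{x. \<phi> x \<noteq> 0}"] by (auto simp: indicator_def)
  have \<phi>m: "\<phi> \<in> borel_measurable lebesgue"
    using smooth_continuous_on[OF sm] by (intro measurable_completion) (auto intro: borel_measurable_continuous_onI)
  have "integrable lebesgue (\<lambda>x. indicator U x *\<^sub>R (f x * \<phi> x))"
    unfolding eq
  proof (rule Bochner_Integration.integrable_bound[OF integrable_mult_right[OF integrable_norm[OF int], of B]])
    show "(\<lambda>x. \<phi> x * (indicator ?K x *\<^sub>R f x)) \<in> borel_measurable lebesgue"
      by (intro \<phi>m borel_measurable_times borel_measurable_integrable[OF int])
  next
    show "AE x in lebesgue. norm (\<phi> x * (indicator ?K x *\<^sub>R f x)) \<le> norm (B * norm (indicator ?K x *\<^sub>R f x))"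
    proof (rule AE_I2)
      fix x
      have "0 \<le> B" if "x \<in> ?K" using B[OF that] norm_ge_zero order_trans by blast
      then show "norm (\<phi> x * (indicator ?K x *\<^sub>R f x)) \<le> norm (B * norm (indicator ?K x *\<^sub>R f x))"
        using B[of x] by (cases "x \<in> ?K") (auto simp: norm_mult intro!: mult_right_mono)
    qed
  qed
  then show ?thesis using U by (simp add: integrable_restrict_space)
qed

lemma has_weak_partial_diff:
  assumes U: "U \<in> sets lebesgue" and u: "has_weak_partial U i u g" and v: "has_weak_partial U i v h"
  shows "has_weak_partial U i (\<lambda>x. u x - v x) (\<lambda>x. g x - h x)"
  unfolding has_weak_partial_def
proof (intro conjI allI impI)
  show "locally_integrable U (\<lambda>x. u x - v x)" "locally_integrable U (\<lambda>x. g x - h x)"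
    using u v by (auto simp: has_weak_partial_def locally_integrable_def)
  fix \<phi> assume \<phi>: "test_fun U \<phi>"
  have "integrable (lebesgue_on U) (\<lambda>x. u x * partial_deriv i \<phi> x)"
    "integrable (lebesgue_on U) (\<lambda>x. v x * partial_deriv i \<phi> x)"
    "integrable (lebesgue_on U) (\<lambda>x. g x * \<phi> x)" "integrable (lebesgue_on U) (\<lambda>x. h x * \<phi> x)"
    using u v by (auto simp: has_weak_partial_def intro!: integrable_mult_test_fun U \<phi> test_fun_partial_deriv)
  then show "(\<integral>x. (u x - v x) * partial_deriv i \<phi> x \<partial>lebesgue_on U) = - (\<integral>x. (g x - h x) * \<phi> x \<partial>lebesgue_on U)"
    using u v \<phi> by (simp add: has_weak_partial_def left_diff_distrib)
qed

lemma has_weak_partial_cmult: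
  assumes "has_weak_partial U i u g"
  shows "has_weak_partial U i (\<lambda>x. c * u x) (\<lambda>x. c * g x)"
  using assms by (auto simp: has_weak_partial_def locally_integrable_def mult.assoc)

text \<open>The difference g - h is a weak derivative of u - u = 0, so all its integrals against
  test functions vanish.\<close>

lemma has_weak_partial_unique:
  assumes U: "open U" and g: "has_weak_partial U i u g" and h: "has_weak_partial U i u h"
  shows "AE x in lebesgue_on U. g x = h x"
proof -
  have Um: "U \<in> sets lebesgue" using U by auto
  have "has_weak_partial U i (\<lambda>x. u x - u x) (\<lambda>x. g x - h x)"
    by (rule has_weak_partial_diff[OF Um g h])
  then have "AE x in lebesgue_on U. g x - h x = 0"
    by (intro AE_zero_if_test_integrals_zero[OF U]) (auto simp: has_weak_partial_def)
  then show ?thesis by simp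
qed

text \<open>Makes the representative picked by \<open>SOME\<close> computable: any exhibited weak
  derivative may replace it off a null set.\<close>

lemma weak_partial_AE_eq:
  assumes "open U" "has_weak_partial U i u g"
  shows "AE x in lebesgue_on U. weak_partial U i u x = g x"
  using has_weak_partial_unique[OF assms(1) _ assms(2)] someI[of "has_weak_partial U i u", OF assms(2)]
  unfolding weak_partial_def by blast

lemma locally_integrable_cong_AE:
  assumes U: "U \<in> sets lebesgue" and eq: "AE x in lebesgue_on U. u x = v x"
    and u: "locally_integrable U u"
  shows "locally_integrable U v"
  unfolding locally_integrable_def
proof (intro allI impI)
  fix K assume K: "compact K \<and> K \<subseteq> U"
  then have Km: "K \<in> sets lebesgue" by (auto intro: fmeasurableD[OF lmeasurable_compact])
  have "AE x in lebesgue_on K. u x = v x"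
    using eq K U Km by (auto simp: AE_restrict_space_iff elim!: eventually_mono)
  from lebesgue_on_cong_AE(1)[OF Km this] u K show "integrable (lebesgue_on K) v"
    by (simp add: locally_integrable_def)
qed

lemma has_weak_partial_cong_AE:
  assumes U: "U \<in> sets lebesgue" and eq: "AE x in lebesgue_on U. u x = v x"
    and u: "has_weak_partial U i u g"
  shows "has_weak_partial U i v g"
  unfolding has_weak_partial_def
proof (intro conjI allI impI)
  show "locally_integrable U v" "locally_integrable U g"
    using locally_integrable_cong_AE[OF U eq] u by (auto simp: has_weak_partial_def)
  fix \<phi> assume \<phi>: "test_fun U \<phi>"
  have "AE x in lebesgue_on U. v x * partial_deriv i \<phi> x = u x * partial_deriv i \<phi> x"
    using eq by eventually_elim simp
  from lebesgue_on_cong_AE(2)[OF U this] u \<phi>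
  show "(\<integral>x. v x * partial_deriv i \<phi> x \<partial>lebesgue_on U) = - (\<integral>x. g x * \<phi> x \<partial>lebesgue_on U)"
    by (simp add: has_weak_partial_def)
qed

text \<open>A compact set has finite measure, so the constant 1 is square integrable there and may
  be paired with f.\<close>

lemma L2_space_locally_integrable:
  fixes f :: "real ^ 'n::finite \<Rightarrow> complex"
  assumes U: "U \<in> sets lebesgue" and f: "f \<in> L2_space U"
  shows "locally_integrable U f"
  unfolding locally_integrable_def
proof (intro allI impI)
  fix K :: "(real^'n) set" assume K: "compact K \<and> K \<subseteq> U"
  then have Km: "K \<in> sets lebesgue" by (auto intro: fmeasurableD[OF lmeasurable_compact])
  have "set_integrable lebesgue U (\<lambda>x. (norm (f x))\<^sup>2)"
    using f U by (simp add: L2_space_def integrable_restrict_space set_integrable_def)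
  then have "set_integrable lebesgue K (\<lambda>x. (norm (f x))\<^sup>2)"
    by (rule set_integrable_subset) (use K Km in auto)
  moreover have "f \<in> borel_measurable (lebesgue_on K)"
    by (rule measurable_restrict_mono[of f lebesgue U]) (use f K in \<open>auto simp: L2_space_def\<close>)
  ultimately have fK: "L2fun (lebesgue_on K) f"
    using Km by (simp add: L2fun_def integrable_restrict_space set_integrable_def)
  have "finite_measure (lebesgue_on K)"
    using K by (intro finite_measure_lebesgue_on lmeasurable_compact) simp
  then have "L2fun (lebesgue_on K) (\<lambda>_. 1)"
    using finite_measure.integrable_const[of "lebesgue_on K" "1::real"] by (simp add: L2fun_def)
  from L2fun_mult_integrable[OF fK this] show "integrable (lebesgue_on K) f" by simp
qed

section \<open>Integration by parts with a weight, and classical derivatives as weak ones\<close>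

lemma integrable_continuous_box:
  fixes f :: "'a::euclidean_space \<Rightarrow> 'b::euclidean_space"
  assumes "continuous_on UNIV f"
  shows "integrable (lebesgue_on (box a b)) f"
proof -
  have "set_integrable lebesgue (box a b) f"
    by (rule set_integrable_subset[OF absolutely_integrable_continuous[OF continuous_on_subset[OF assms], of a b]])
      (auto intro: box_subset_cbox[THEN subsetD])
  then show ?thesis by (simp add: integrable_restrict_space set_integrable_def)
qed

lemma L2fun_continuous_box:
  assumes "continuous_on UNIV f"
  shows "L2fun (lebesgue_on (box a b)) f"
  unfolding L2fun_def
proof
  show "f \<in> borel_measurable (lebesgue_on (box a b))"
    by (intro borel_measurable_integrable integrable_continuous_box assms)
  show "integrable (lebesgue_on (box a b)) (\<lambda>x. (norm (f x))\<^sup>2)"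
    by (intro integrable_continuous_box continuous_intros assms)
qed

text \<open>The weight m is constant along direction i, so differentiating m f g produces no term
  with m', and m agrees at opposite points of the two faces. It is applied with m = 1 for weak
  derivatives and with m = x_j, j different from i, for the angular momentum.\<close>

lemma integration_by_parts_box:
  fixes f g :: "real ^ 'n::finite \<Rightarrow> complex" and m :: "real ^ 'n \<Rightarrow> complex"
  assumes f: "\<And>x. (f has_derivative f' x) (at x)" "continuous_on UNIV (\<lambda>x. f' x (axis i 1))"
    and g: "\<And>x. (g has_derivative g' x) (at x)" "continuous_on UNIV (\<lambda>x. g' x (axis i 1))"
    and m: "\<And>x. (m has_derivative m' x) (at x)" "\<And>x. m' x (axis i 1) = 0"
      "\<And>x s. m (x + s *\<^sub>R axis i 1) = m x"
    and box: "box a b \<noteq> {}" and \<delta>: "0 < \<delta>"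
    and per: "\<And>x. x \<in> cbox a b \<Longrightarrow> x $ i \<le> a $ i + \<delta> \<Longrightarrow>
      f (x + (b $ i - a $ i) *\<^sub>R axis i 1) * g (x + (b $ i - a $ i) *\<^sub>R axis i 1) = f x * g x"
  shows "(\<integral>x. m x * (f' x (axis i 1) * g x + f x * g' x (axis i 1)) \<partial>lebesgue_on (box a b)) = 0"
proof -
  have cont: "continuous_on UNIV f" "continuous_on UNIV g" "continuous_on UNIV m"
    using f(1) g(1) m(1) by (auto simp: continuous_on_eq_continuous_at intro: has_derivative_continuous)
  let ?F' = "\<lambda>x h. m x * (f x * g' x h + f' x h * g x) + m' x h * (f x * g x)"
  have "(\<integral>x. ?F' x (axis i 1) \<partial>lebesgue_on (box a b)) = 0"
  proof (rule integral_partial_box_eq_0[OF _ _ box \<delta>])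
    show "((\<lambda>x. m x * (f x * g x)) has_derivative ?F' x) (at x)" for x
      by (intro has_derivative_mult f g m)
    show "continuous_on UNIV (\<lambda>x. ?F' x (axis i 1))"
      unfolding m(2) by (intro continuous_intros cont f g)
  qed (simp add: per m(3))
  then show ?thesis by (simp add: m(2) add.commute)
qed

text \<open>The two faces are treated asymmetrically because the shift argument compares a collar
  inside the lower face with points beyond the upper face.\<close>

lemma test_fun_box_near_face:
  assumes \<phi>: "test_fun (box a b) \<phi>"
  obtains \<delta> where "0 < \<delta>" "\<And>x. x $ i \<le> a $ i + \<delta> \<Longrightarrow> \<phi> x = 0" "\<And>x. b $ i \<le> x $ i \<Longrightarrow> \<phi> x = 0"
proof -
  let ?K = "closure {x. \<phi> x \<noteq> 0}"
  have K: "compact ?K" "?K \<subseteq> box a b" using \<phi> by (auto simp: test_fun_def)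
  have inK: "x \<in> ?K" if "\<phi> x \<noteq> 0" for x using that closure_subset by force
  have right: "\<phi> x = 0" if "b $ i \<le> x $ i" for x
  proof (rule ccontr)
    assume "\<phi> x \<noteq> 0"
    with inK K(2) have "x \<in> box a b" by blast
    with that show False by (auto simp: mem_box_cart not_less[symmetric])
  qed
  show thesis
  proof (cases "?K = {}")
    case True
    with inK have "\<phi> x = 0" for x by blast
    then show thesis by (intro that[of 1]) auto
  next
    case False
    have "continuous_on ?K (\<lambda>x. x $ i)" by (intro continuous_intros)
    from continuous_attains_inf[OF K(1) False this] obtain y where y: "y \<in> ?K" "\<And>x. x \<in> ?K \<Longrightarrow> y $ i \<le> x $ i"
      by blast
    have ya: "a $ i < y $ i" using y(1) K(2) by (auto simp: mem_box_cart)
    \<comment> \<open>The collar is half as wide as the gap between the lower face and a point y of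
      the support closest to it.\<close>
    show thesis
    proof (rule that[of "(y $ i - a $ i) / 2"])
      show "\<phi> x = 0" if "x $ i \<le> a $ i + (y $ i - a $ i) / 2" for x
        using that ya y(2)[OF inK[of x]] by (auto simp: field_simps)
    qed (use ya right in auto)
  qed
qed

text \<open>f obeys no boundary condition here: the test function vanishes near the lower face and
  beyond the upper one, hence so does the product. This links the smooth approximations of energy
  space functions to weak derivatives.\<close>

lemma smooth_has_weak_partial:
  fixes a b :: "real ^ 'n::finite"
  assumes f: "smooth f" and box: "box a b \<noteq> {}"
  shows "has_weak_partial (box a b) i f (partial_deriv i f)"
  unfolding has_weak_partial_def
proof (intro conjI allI impI)
  have li: "locally_integrable (box a b) g" if "smooth g" for g
    using L2fun_continuous_box[OF smooth_continuous_on[OF that]]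
    by (intro L2_space_locally_integrable) (auto simp: L2_space_iff)
  show lif: "locally_integrable (box a b) f" "locally_integrable (box a b) (partial_deriv i f)"
    by (intro li f smooth_partial_deriv)+
  fix \<phi> assume \<phi>: "test_fun (box a b) \<phi>"
  then have sm: "smooth \<phi>" by (simp add: test_fun_def)
  obtain \<delta> where \<delta>: "0 < \<delta>" "\<And>x. x $ i \<le> a $ i + \<delta> \<Longrightarrow> \<phi> x = 0" "\<And>x. b $ i \<le> x $ i \<Longrightarrow> \<phi> x = 0"
    using test_fun_box_near_face[OF \<phi>] by blast
  have "(\<integral>x. 1 * (frechet_derivative f (at x) (axis i 1) * \<phi> x + f x * frechet_derivative \<phi> (at x) (axis i 1)) \<partial>lebesgue_on (box a b)) = 0"
  proof (rule integration_by_parts_box[OF smooth_has_derivative[OF f] _ smooth_has_derivative[OF sm] _ _ _ _ box \<delta>(1)])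
    show "((\<lambda>x. 1) has_derivative (\<lambda>_. 0)) (at x)" for x :: "real^'n" by simp
    show "continuous_on UNIV (\<lambda>x. frechet_derivative f (at x) (axis i 1))"
      "continuous_on UNIV (\<lambda>x. frechet_derivative \<phi> (at x) (axis i 1))"
      using smooth_continuous_on[OF smooth_partial_deriv[OF f]] smooth_continuous_on[OF smooth_partial_deriv[OF sm]]
      unfolding partial_deriv_def by auto
    fix x assume "x \<in> cbox a b" "x $ i \<le> a $ i + \<delta>"
    then show "f (x + (b $ i - a $ i) *\<^sub>R axis i 1) * \<phi> (x + (b $ i - a $ i) *\<^sub>R axis i 1) = f x * \<phi> x"
      using \<delta>(2)[of x] \<delta>(3)[of "x + (b $ i - a $ i) *\<^sub>R axis i 1"] by (simp add: mem_box_cart)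
  qed auto
  moreover have "integrable (lebesgue_on (box a b)) (\<lambda>x. partial_deriv i f x * \<phi> x)"
    "integrable (lebesgue_on (box a b)) (\<lambda>x. f x * partial_deriv i \<phi> x)"
    by (intro integrable_mult_test_fun lif \<phi> test_fun_partial_deriv; simp)+
  ultimately show "(\<integral>x. f x * partial_deriv i \<phi> x \<partial>lebesgue_on (box a b)) =
      - (\<integral>x. partial_deriv i f x * \<phi> x \<partial>lebesgue_on (box a b))"
    by (simp flip: partial_deriv_def add: eq_neg_iff_add_eq_0 add.commute)
qed

subsection \<open>The energy space and the symmetry of the angular momentum operator\<close>

lemma L2fun_cong_AE:
  fixes f g :: "'a::euclidean_space \<Rightarrow> complex"
  assumes S: "S \<in> sets lebesgue" and eq: "AE x in lebesgue_on S. f x = g x"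
    and f: "L2fun (lebesgue_on S) f"
  shows "L2fun (lebesgue_on S) g"
proof -
  have "AE x in lebesgue_on S. (norm (f x))\<^sup>2 = (norm (g x))\<^sup>2"
    using eq by eventually_elim simp
  from lebesgue_on_cong_AE(1)[OF S this] borel_measurable_lebesgue_on_cong_AE[OF S _ eq] f
  show ?thesis by (simp add: L2fun_def)
qed

lemma H1_space_L2fun: "u \<in> H1_space U \<Longrightarrow> L2fun (lebesgue_on U) u"
  by (simp add: H1_space_def L2_space_iff)

lemma H1_space_weak_partial:
  assumes U: "open U" and u: "u \<in> H1_space U"
  shows "has_weak_partial U i u (weak_partial U i u)" "L2fun (lebesgue_on U) (weak_partial U i u)"
proof -
  obtain g where g: "L2fun (lebesgue_on U) g" "has_weak_partial U i u g"
    using u by (auto simp: H1_space_def L2_space_iff)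
  show "has_weak_partial U i u (weak_partial U i u)"
    unfolding weak_partial_def by (rule someI[of "has_weak_partial U i u", OF g(2)])
  have "AE x in lebesgue_on U. g x = weak_partial U i u x"
    using weak_partial_AE_eq[OF U g(2)] by eventually_elim simp
  from L2fun_cong_AE[OF _ this g(1)] show "L2fun (lebesgue_on U) (weak_partial U i u)"
    using U by auto
qed

lemma H1_norm_tendsto_0D:
  assumes lim: "(\<lambda>k. H1_norm U (w k)) \<longlonglongrightarrow> 0"
  shows "(\<lambda>k. \<integral>x. (norm (w k x))\<^sup>2 \<partial>lebesgue_on U) \<longlonglongrightarrow> 0"
    and "(\<lambda>k. \<integral>x. (norm (weak_partial U i (w k) x))\<^sup>2 \<partial>lebesgue_on U) \<longlonglongrightarrow> 0"
proof -
  let ?A = "\<lambda>k. \<integral>x. (norm (w k x))\<^sup>2 \<partial>lebesgue_on U"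
  let ?B = "\<lambda>i k. \<integral>x. (norm (weak_partial U i (w k) x))\<^sup>2 \<partial>lebesgue_on U"
  have nn: "0 \<le> ?A k" "0 \<le> ?B i k" for i k
    by (auto intro!: Bochner_Integration.integral_nonneg)
  have sq: "(H1_norm U (w k))\<^sup>2 = ?A k + (\<Sum>i\<in>UNIV. ?B i k)" for k
    unfolding H1_norm_def using nn by (intro real_sqrt_pow2 add_nonneg_nonneg sum_nonneg) auto
  have lim2: "(\<lambda>k. (H1_norm U (w k))\<^sup>2) \<longlonglongrightarrow> 0"
    using tendsto_power[OF lim, of 2] by simp
  have "?A k \<le> (H1_norm U (w k))\<^sup>2" for k
    unfolding sq using nn by (simp add: sum_nonneg)
  with nn show "?A \<longlonglongrightarrow> 0"
    by (intro tendsto_sandwich[OF _ _ tendsto_const lim2]) auto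
  have "?B i k \<le> (\<Sum>i\<in>UNIV. ?B i k)" for k
    by (rule member_le_sum) (use nn in auto)
  then have "?B i k \<le> (H1_norm U (w k))\<^sup>2" for k
    unfolding sq using nn(1)[of k] by (meson add_increasing order_refl order_trans)
  with nn show "?B i \<longlonglongrightarrow> 0"
    by (intro tendsto_sandwich[OF _ _ tendsto_const lim2]) auto
qed

text \<open>One predicate for the class whose closure is the energy space, whichever the boundary
  condition; \<open>smooth\<close> stands outside the case distinction so that it is available
  without splitting cases.\<close>

definition boundary_fun ::
  "boundary_condition \<Rightarrow> real ^ 'n::finite \<Rightarrow> real ^ 'n \<Rightarrow> (real ^ 'n \<Rightarrow> complex) \<Rightarrow> bool" where
  "boundary_fun bc a b \<phi> \<longleftrightarrow> smooth \<phi> \<and>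
     (case bc of Dirichlet \<Rightarrow> test_fun (box a b) \<phi> | Periodic \<Rightarrow> box_periodic a b \<phi>)"

lemma H1_bc_imp_H1_space: "u \<in> H1_bc bc a b \<Longrightarrow> u \<in> H1_space (box a b)"
  by (cases bc) (auto simp: H1_closure_def)

text \<open>The choice of representatives is not linear, so the derivative part of
  \<open>H1_norm\<close> at a difference has to be rewritten, up to null sets, as the difference of
  the derivatives.\<close>

lemma H1_bc_approx:
  assumes u: "u \<in> H1_bc bc a b" and box: "box a b \<noteq> {}"
  obtains \<phi> where "\<And>k::nat. boundary_fun bc a b (\<phi> k)"
    "(\<lambda>k. \<integral>x. (norm (u x - \<phi> k x))\<^sup>2 \<partial>lebesgue_on (box a b)) \<longlonglongrightarrow> 0"
    "\<And>i. (\<lambda>k. \<integral>x. (norm (weak_partial (box a b) i u x - partial_deriv i (\<phi> k) x))\<^sup>2 \<partial>lebesgue_on (box a b)) \<longlonglongrightarrow> 0"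
proof -
  let ?U = "box a b"
  obtain \<phi> where \<phi>: "\<And>k::nat. boundary_fun bc a b (\<phi> k)"
    and lim: "(\<lambda>k. H1_norm ?U (\<lambda>x. u x - \<phi> k x)) \<longlonglongrightarrow> 0"
    using u by (cases bc) (auto simp: H1_closure_def boundary_fun_def test_fun_def)
  show thesis
  proof (rule that[OF \<phi>])
    show "(\<lambda>k. \<integral>x. (norm (u x - \<phi> k x))\<^sup>2 \<partial>lebesgue_on ?U) \<longlonglongrightarrow> 0"
      by (rule H1_norm_tendsto_0D(1)[OF lim])
    fix i
    have "(\<integral>x. (norm (weak_partial ?U i (\<lambda>x. u x - \<phi> k x) x))\<^sup>2 \<partial>lebesgue_on ?U) =
       (\<integral>x. (norm (weak_partial ?U i u x - partial_deriv i (\<phi> k) x))\<^sup>2 \<partial>lebesgue_on ?U)" for k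
    proof (rule lebesgue_on_cong_AE(2))
      have "has_weak_partial ?U i (\<lambda>x. u x - \<phi> k x) (\<lambda>x. weak_partial ?U i u x - partial_deriv i (\<phi> k) x)"
        using \<phi>[of k] H1_space_weak_partial(1)[OF open_box H1_bc_imp_H1_space[OF u]]
        by (intro has_weak_partial_diff smooth_has_weak_partial box) (auto simp: boundary_fun_def)
      from weak_partial_AE_eq[OF open_box this]
      show "AE x in lebesgue_on ?U. (norm (weak_partial ?U i (\<lambda>x. u x - \<phi> k x) x))\<^sup>2 =
         (norm (weak_partial ?U i u x - partial_deriv i (\<phi> k) x))\<^sup>2"
        by eventually_elim simp
    qed simp
    with H1_norm_tendsto_0D(2)[OF lim, of i]
    show "(\<lambda>k. \<integral>x. (norm (weak_partial ?U i u x - partial_deriv i (\<phi> k) x))\<^sup>2 \<partial>lebesgue_on ?U) \<longlonglongrightarrow> 0"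
      by simp
  qed
qed

text \<open>Since i differs from j, the factor x_j is equal at opposite points of the faces normal
  to direction i; hence the periodic case goes through although x_j itself is not periodic. In the
  Dirichlet case a collar for \<phi> alone serves the product.\<close>

lemma boundary_fun_integration_by_parts:
  fixes \<phi> \<psi> :: "real ^ 'n::finite \<Rightarrow> complex"
  assumes \<phi>: "boundary_fun bc a b \<phi>" and \<psi>: "boundary_fun bc a b \<psi>"
    and box: "box a b \<noteq> {}" and ij: "i \<noteq> j"
  shows "(\<integral>x. of_real (x $ j) * (partial_deriv i \<phi> x * cnj (\<psi> x) + \<phi> x * cnj (partial_deriv i \<psi> x))
    \<partial>lebesgue_on (box a b)) = 0"
proof -
  have sm: "smooth \<phi>" "smooth \<psi>" using \<phi> \<psi> by (auto simp: boundary_fun_def)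
  obtain \<delta> where \<delta>: "0 < \<delta>" "\<And>x. x \<in> cbox a b \<Longrightarrow> x $ i \<le> a $ i + \<delta> \<Longrightarrow>
      \<phi> (x + (b $ i - a $ i) *\<^sub>R axis i 1) * cnj (\<psi> (x + (b $ i - a $ i) *\<^sub>R axis i 1)) = \<phi> x * cnj (\<psi> x)"
  proof (cases bc)
    case Dirichlet
    with \<phi> have "test_fun (box a b) \<phi>" by (simp add: boundary_fun_def)
    from test_fun_box_near_face[OF this, of i] obtain \<delta> where
      d: "0 < \<delta>" "\<And>x. x $ i \<le> a $ i + \<delta> \<Longrightarrow> \<phi> x = 0" "\<And>x. b $ i \<le> x $ i \<Longrightarrow> \<phi> x = 0" by blast
    show thesis
    proof (rule that[OF d(1)])
      fix x assume "x \<in> cbox a b" "x $ i \<le> a $ i + \<delta>"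
      then show "\<phi> (x + (b $ i - a $ i) *\<^sub>R axis i 1) * cnj (\<psi> (x + (b $ i - a $ i) *\<^sub>R axis i 1)) = \<phi> x * cnj (\<psi> x)"
        using d(2)[of x] d(3)[of "x + (b $ i - a $ i) *\<^sub>R axis i 1"] by (simp add: mem_box_cart)
    qed
  next
    case Periodic
    with \<phi> \<psi> show thesis by (intro that[of 1]) (auto simp: boundary_fun_def box_periodic_def)
  qed
  have "(\<integral>x. of_real (x $ j) * (frechet_derivative \<phi> (at x) (axis i 1) * cnj (\<psi> x)
      + \<phi> x * cnj (frechet_derivative \<psi> (at x) (axis i 1))) \<partial>lebesgue_on (box a b)) = 0"
  proof (rule integration_by_parts_box[OF smooth_has_derivative[OF sm(1)] _ _ _ _ _ _ box \<delta>, where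
        m' = "\<lambda>x h. of_real (h $ j)"])
    show "((\<lambda>x. cnj (\<psi> x)) has_derivative (\<lambda>h. cnj (frechet_derivative \<psi> (at x) h))) (at x)" for x
      by (rule bounded_linear.has_derivative[OF bounded_linear_cnj smooth_has_derivative[OF sm(2)]])
    show "((\<lambda>x. complex_of_real (x $ j)) has_derivative (\<lambda>h. of_real (h $ j))) (at x)" for x :: "real^'n"
      by (intro has_derivative_of_real bounded_linear_imp_has_derivative bounded_linear_vec_nth)
    show "continuous_on UNIV (\<lambda>x. frechet_derivative \<phi> (at x) (axis i 1))"
      using smooth_continuous_on[OF smooth_partial_deriv[OF sm(1)]] unfolding partial_deriv_def .
    show "continuous_on UNIV (\<lambda>x. cnj (frechet_derivative \<psi> (at x) (axis i 1)))"
      using smooth_continuous_on[OF smooth_partial_deriv[OF sm(2)]] unfolding partial_deriv_def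
      by (intro continuous_intros)
  qed (use ij in \<open>auto simp: axis_def\<close>)
  then show ?thesis by (simp add: partial_deriv_def)
qed

lemma L2fun_tendsto_bounded_mult:
  assumes m: "m \<in> borel_measurable M" "AE x in M. norm (m x) \<le> C"
    and f: "\<And>k::nat. L2fun M (f k)" and lim: "(\<lambda>k. \<integral>x. (norm (f k x))\<^sup>2 \<partial>M) \<longlonglongrightarrow> 0"
  shows "(\<lambda>k. \<integral>x. (norm (m x * f k x))\<^sup>2 \<partial>M) \<longlonglongrightarrow> 0"
proof (rule tendsto_sandwich[OF _ _ tendsto_const])
  show "(\<lambda>k. C\<^sup>2 * (\<integral>x. (norm (f k x))\<^sup>2 \<partial>M)) \<longlonglongrightarrow> 0"
    using tendsto_mult_right_zero[OF lim] .
  have "(\<integral>x. (norm (m x * f k x))\<^sup>2 \<partial>M) \<le> (\<integral>x. C\<^sup>2 * (norm (f k x))\<^sup>2 \<partial>M)" for k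
  proof (rule integral_mono_AE)
    show "AE x in M. (norm (m x * f k x))\<^sup>2 \<le> C\<^sup>2 * (norm (f k x))\<^sup>2"
      using m(2) by eventually_elim (auto simp: norm_mult power_mult_distrib intro!: mult_right_mono power_mono)
  qed (use L2fun_bounded_mult[OF m f] f in \<open>auto simp: L2fun_def\<close>)
  then show "\<forall>\<^sub>F k in sequentially. (\<integral>x. (norm (m x * f k x))\<^sup>2 \<partial>M) \<le> C\<^sup>2 * (\<integral>x. (norm (f k x))\<^sup>2 \<partial>M)"
    by simp
qed (auto intro!: always_eventually Bochner_Integration.integral_nonneg)

lemma coordinate_bounded_on_box:
  fixes a b :: "real ^ 'n::finite"
  obtains C where "AE x in lebesgue_on (box a b). norm (complex_of_real (x $ j)) \<le> C"
    "(\<lambda>x. complex_of_real (x $ j)) \<in> borel_measurable (lebesgue_on (box a b))"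
proof -
  obtain C where C: "\<And>x. x \<in> box a b \<Longrightarrow> norm x \<le> C"
    using bounded_box[of a b] unfolding bounded_iff by blast
  show thesis
  proof (rule that)
    show "AE x in lebesgue_on (box a b). norm (complex_of_real (x $ j)) \<le> C"
      by (rule AE_I2) (use C component_le_norm_cart order_trans in fastforce)
    show "(\<lambda>x. complex_of_real (x $ j)) \<in> borel_measurable (lebesgue_on (box a b))"
      by (intro borel_measurable_integrable integrable_continuous_box continuous_intros)
  qed
qed

text \<open>Each of the two summands is a continuous pairing in L^2 of functions and derivatives,
  with the bounded weight x_j absorbed into one factor, so
  \<open>boundary_fun_integration_by_parts\<close> passes to the limit term by term.\<close>

lemma H1_bc_integration_by_parts:
  fixes u v :: "real ^ 'n::finite \<Rightarrow> complex"
  assumes u: "u \<in> H1_bc bc a b" and v: "v \<in> H1_bc bc a b"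
    and box: "box a b \<noteq> {}" and ij: "i \<noteq> j"
  shows "(\<integral>x. of_real (x $ j) * (weak_partial (box a b) i u x * cnj (v x) + u x * cnj (weak_partial (box a b) i v x))
    \<partial>lebesgue_on (box a b)) = 0"
proof -
  let ?U = "box a b" and ?M = "lebesgue_on (box a b)"
  let ?m = "\<lambda>x. complex_of_real (x $ j)"
  obtain C where m: "?m \<in> borel_measurable ?M" "AE x in ?M. norm (?m x) \<le> C"
    using coordinate_bounded_on_box by blast
  obtain \<phi> where \<phi>: "\<And>k::nat. boundary_fun bc a b (\<phi> k)"
    "(\<lambda>k. \<integral>x. (norm (u x - \<phi> k x))\<^sup>2 \<partial>?M) \<longlonglongrightarrow> 0"
    "\<And>i. (\<lambda>k. \<integral>x. (norm (weak_partial ?U i u x - partial_deriv i (\<phi> k) x))\<^sup>2 \<partial>?M) \<longlonglongrightarrow> 0"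
    using H1_bc_approx[OF u box] by blast
  obtain \<psi> where \<psi>: "\<And>k::nat. boundary_fun bc a b (\<psi> k)"
    "(\<lambda>k. \<integral>x. (norm (v x - \<psi> k x))\<^sup>2 \<partial>?M) \<longlonglongrightarrow> 0"
    "\<And>i. (\<lambda>k. \<integral>x. (norm (weak_partial ?U i v x - partial_deriv i (\<psi> k) x))\<^sup>2 \<partial>?M) \<longlonglongrightarrow> 0"
    using H1_bc_approx[OF v box] by blast
  have L: "L2fun ?M u" "L2fun ?M v" "L2fun ?M (weak_partial ?U i u)" "L2fun ?M (weak_partial ?U i v)"
    by (intro H1_space_L2fun H1_space_weak_partial(2)[OF open_box] H1_bc_imp_H1_space[OF u] H1_bc_imp_H1_space[OF v])+
  have sm: "smooth (\<phi> k)" "smooth (\<psi> k)" for k using \<phi> \<psi> by (auto simp: boundary_fun_def)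
  then have L': "L2fun ?M (\<phi> k)" "L2fun ?M (\<psi> k)"
    "L2fun ?M (partial_deriv i (\<phi> k))" "L2fun ?M (partial_deriv i (\<psi> k))" for k
    by (auto intro!: L2fun_continuous_box smooth_continuous_on smooth_partial_deriv)
  note mult = L2fun_bounded_mult[OF m]
  note lim0 = L2fun_tendsto_bounded_mult[OF m]
  have lim1: "(\<lambda>k. \<integral>x. (?m x * partial_deriv i (\<phi> k) x) * cnj (\<psi> k x) \<partial>?M)
      \<longlonglongrightarrow> (\<integral>x. (?m x * weak_partial ?U i u x) * cnj (v x) \<partial>?M)"
    using \<psi>(2) lim0[OF L2fun_diff[OF L(3) L'(3)] \<phi>(3)]
    by (intro L2fun_product_tendsto) (auto intro!: L L' mult L2fun_cnj simp flip: complex_cnj_diff right_diff_distrib)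
  have lim2: "(\<lambda>k. \<integral>x. (?m x * \<phi> k x) * cnj (partial_deriv i (\<psi> k) x) \<partial>?M)
      \<longlonglongrightarrow> (\<integral>x. (?m x * u x) * cnj (weak_partial ?U i v x) \<partial>?M)"
    using \<psi>(3) lim0[OF L2fun_diff[OF L(1) L'(1)] \<phi>(2)]
    by (intro L2fun_product_tendsto) (auto intro!: L L' mult L2fun_cnj simp flip: complex_cnj_diff right_diff_distrib)
  have split: "(\<integral>x. ?m x * (p x * cnj (q x) + r x * cnj (s x)) \<partial>?M) =
      (\<integral>x. (?m x * p x) * cnj (q x) \<partial>?M) + (\<integral>x. (?m x * r x) * cnj (s x) \<partial>?M)"
    if "L2fun ?M p" "L2fun ?M q" "L2fun ?M r" "L2fun ?M s" for p q r s
    using L2fun_mult_integrable[OF mult[OF that(1)] L2fun_cnj[OF that(2)]]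
      L2fun_mult_integrable[OF mult[OF that(3)] L2fun_cnj[OF that(4)]]
    by (simp add: distrib_left mult.assoc)
  have "(\<integral>x. (?m x * partial_deriv i (\<phi> k) x) * cnj (\<psi> k x) \<partial>?M) +
        (\<integral>x. (?m x * \<phi> k x) * cnj (partial_deriv i (\<psi> k) x) \<partial>?M) = 0" for k
    using boundary_fun_integration_by_parts[OF \<phi>(1) \<psi>(1) box ij] by (simp add: split L')
  with tendsto_add[OF lim1 lim2] show ?thesis
    by (simp only: split L LIMSEQ_const_iff)
qed

subsection \<open>The energy inequality\<close>

text \<open>\<open>W\<close> is the real part of the weak equation, moved to one side, as an
  integrand for the test function v, with G for the gradient pairing. Testing with 2 (w - u) yields
  \<open>2 * (W Gw w - W Gwu u)\<close>, and the last term is the defect of symmetry of L_z; both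
  will integrate to zero. Gradients enter only through real numbers related by polarization, which
  leaves pure algebra.\<close>

lemma energy_difference_identity:
  fixes w u Lw Lu :: complex and \<alpha> \<tau> \<Omega> P s :: real
  defines "W \<equiv> \<lambda>G v. 1 / 2 * G + Re ((w - u) / of_real \<tau> * cnj v) + \<alpha> * Re (w * cnj v)
       - Re ((of_real (\<alpha> - P + s) * u + of_real \<Omega> * Lu) * cnj v)"
  assumes Ge: "Ge = Gw + Gu - 2 * Gwu"
  shows "(1 / 2 * Gw + P * (norm w)\<^sup>2 - \<Omega> * Re (cnj w * Lw)) - (1 / 2 * Gu + P * (norm u)\<^sup>2 - \<Omega> * Re (cnj u * Lu))
    = s * ((norm w)\<^sup>2 - (norm u)\<^sup>2)
      - (2 / \<tau> * (norm (w - u))\<^sup>2 + (1 / 2 * Ge + (2 * \<alpha> - P + s) * (norm (w - u))\<^sup>2 + \<Omega> * Re ((Lw - Lu) * cnj (w - u))))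
      + 2 * (W Gw w - W Gwu u) - \<Omega> * (Re (Lw * cnj u) - Re (Lu * cnj w))"
proof -
  \<comment> \<open>The identity is linear in 1/\<tau>; naming this quotient leaves a polynomial
    identity.\<close>
  define k where "k = 1 / \<tau>"
  have k: "z / of_real \<tau> = of_real k * z" "2 / \<tau> = 2 * k" for z :: complex
    by (simp_all add: k_def divide_inverse)
  show ?thesis
    unfolding W_def Ge cmod_power2 k by (simp add: power2_eq_square algebra_simps add_divide_distrib)
qed

text \<open>Integrates the pointwise identity: \<open>weak\<close> removes \<open>W\<close> at both
  test functions, \<open>herm\<close> removes the symmetry defect, and \<open>stab\<close> and
  \<tau> > 0 give the sign of the dropped terms. Each test function is paired with its gradient, for
  which arbitrary square integrable families may stand. The bounds on P and s keep the integrands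
  integrable.\<close>

lemma energy_difference_le:
  fixes M :: "'a measure" and w u Lw Lu :: "'a \<Rightarrow> complex" and Dw Du :: "'i::finite \<Rightarrow> 'a \<Rightarrow> complex"
    and P s :: "'a \<Rightarrow> real" and \<alpha> \<tau> \<Omega> :: real
  defines "E \<equiv> \<lambda>D v L x. of_real (1 / 2 * (\<Sum>i\<in>UNIV. (norm (D i x))\<^sup>2)) + of_real (P x * (norm (v x))\<^sup>2)
      - of_real \<Omega> * cnj (v x) * L x"
  assumes L2: "L2fun M w" "L2fun M u" "L2fun M Lw" "L2fun M Lu" "\<And>i. L2fun M (Dw i)" "\<And>i. L2fun M (Du i)"
    and P: "P \<in> borel_measurable M" "AE x in M. \<bar>P x\<bar> \<le> CP"
    and s: "s \<in> borel_measurable M" "AE x in M. \<bar>s x\<bar> \<le> Cs"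
    and \<tau>: "0 < \<tau>"
    and weak: "\<And>v D. (v, D) \<in> {(w, Dw), (u, Du)} \<Longrightarrow>
      (\<integral>x. (w x - u x) / of_real \<tau> * cnj (v x) \<partial>M) =
          - 1 / 2 * (\<integral>x. (\<Sum>i\<in>UNIV. Dw i x * cnj (D i x)) \<partial>M)
          - of_real \<alpha> * (\<integral>x. w x * cnj (v x) \<partial>M)
          + (\<integral>x. (of_real (\<alpha> - P x + s x) * u x + of_real \<Omega> * Lu x) * cnj (v x) \<partial>M)"
    and herm: "Re (\<integral>x. Lw x * cnj (u x) \<partial>M) = Re (\<integral>x. Lu x * cnj (w x) \<partial>M)"
    and stab: "AE x in M. 0 \<le> 1 / 2 * (\<Sum>i\<in>UNIV. (norm (Dw i x - Du i x))\<^sup>2)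
       + (2 * \<alpha> - P x + s x) * (norm (w x - u x))\<^sup>2 + \<Omega> * Re ((Lw x - Lu x) * cnj (w x - u x))"
  shows "Re (\<integral>x. E Dw w Lw x \<partial>M) - Re (\<integral>x. E Du u Lu x \<partial>M) \<le> (\<integral>x. s x * ((norm (w x))\<^sup>2 - (norm (u x))\<^sup>2) \<partial>M)"
proof -
  note prod = L2fun_mult_integrable[OF _ L2fun_cnj]
  have mP: "L2fun M (\<lambda>x. of_real (P x) * f x)" if "L2fun M f" for f
    by (rule L2fun_bounded_mult[where C=CP]) (use P that in auto)
  have ms: "L2fun M (\<lambda>x. of_real (s x) * f x)" if "L2fun M f" for f
    by (rule L2fun_bounded_mult[where C=Cs]) (use s that in auto)
  have sq: "integrable M (\<lambda>x. (norm (f x))\<^sup>2)" if "L2fun M f" for f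
    using that by (simp add: L2fun_def)
  have msq: "integrable M (\<lambda>x. g x * (norm (f x))\<^sup>2)"
    if "L2fun M f" "L2fun M (\<lambda>x. complex_of_real (g x) * f x)" for f g
    using integrable_Re[OF prod[OF that(2,1)]]
    by (simp add: mult.assoc complex_mult_cnj flip: cmod_power2)
  have Pw: "integrable M (\<lambda>x. P x * (norm (f x))\<^sup>2)" "integrable M (\<lambda>x. s x * (norm (f x))\<^sup>2)" if "L2fun M f" for f
    using that mP ms by (auto intro!: msq)
  define q where "q D v L x = 1 / 2 * (\<Sum>i\<in>UNIV. (norm (D i x))\<^sup>2) + P x * (norm (v x))\<^sup>2 - \<Omega> * Re (cnj (v x) * L x)"
    for D :: "'i \<Rightarrow> 'a \<Rightarrow> complex" and v L x
  have q: "integrable M (q D v L)" "Re (\<integral>x. E D v L x \<partial>M) = (\<integral>x. q D v L x \<partial>M)"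
    if "L2fun M v" "L2fun M L" "\<And>i. L2fun M (D i)" for D :: "'i \<Rightarrow> 'a \<Rightarrow> complex" and v L
  proof -
    have i: "integrable M (\<lambda>x. \<Sum>i\<in>UNIV. (norm (D i x))\<^sup>2)" "integrable M (\<lambda>x. P x * (norm (v x))\<^sup>2)"
      "integrable M (\<lambda>x. cnj (v x) * L x)"
      using that by (auto intro!: sq Pw L2fun_mult_integrable L2fun_cnj)
    have iE: "integrable M (E D v L)"
      unfolding E_def mult.assoc
      by (intro Bochner_Integration.integrable_add Bochner_Integration.integrable_diff
        integrable_of_real integrable_mult_right i)
    have qE: "q D v L x = Re (E D v L x)" for x
      by (simp add: q_def E_def algebra_simps)
    show "integrable M (q D v L)" "Re (\<integral>x. E D v L x \<partial>M) = (\<integral>x. q D v L x \<partial>M)"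
      unfolding qE[abs_def] using iE by (auto intro: integrable_Re)
  qed
  define W where "W D v x = 1 / 2 * Re (\<Sum>i\<in>UNIV. Dw i x * cnj (D i x)) + Re ((w x - u x) / of_real \<tau> * cnj (v x))
      + \<alpha> * Re (w x * cnj (v x)) - Re ((of_real (\<alpha> - P x + s x) * u x + of_real \<Omega> * Lu x) * cnj (v x))"
    for D :: "'i \<Rightarrow> 'a \<Rightarrow> complex" and v x
  have W: "integrable M (W D v)" "(\<integral>x. W D v x \<partial>M) = 0"
    if vD: "(v, D) \<in> {(w, Dw), (u, Du)}" for D v
  proof -
    have L: "L2fun M v" "\<And>i. L2fun M (D i)" using vD L2 by auto
    have i1: "integrable M (\<lambda>x. \<Sum>i\<in>UNIV. Dw i x * cnj (D i x))"
      using L L2 by (intro Bochner_Integration.integrable_sum prod) auto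
    have "L2fun M (\<lambda>x. (w x - u x) / of_real \<tau>)"
      using L2fun_cmult[OF L2fun_diff[OF L2(1,2)], of "1 / of_real \<tau>"] by simp
    note i2 = prod[OF this L(1)]
    note i3 = prod[OF L2(1) L(1)]
    have "L2fun M (\<lambda>x. of_real (\<alpha> - P x + s x) * u x)"
      using L2fun_add[OF L2fun_diff[OF L2fun_cmult[OF L2(2), of "of_real \<alpha>"] mP[OF L2(2)]] ms[OF L2(2)]]
      by (simp add: algebra_simps)
    note i4 = prod[OF L2fun_add[OF this L2fun_cmult[OF L2(4), of "of_real \<Omega>"]] L(1)]
    note i = i1 i2 i3 i4
    show "integrable M (W D v)" unfolding W_def
      using i[THEN integrable_Re] by (intro Bochner_Integration.integrable_add Bochner_Integration.integrable_diff
        integrable_mult_right)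
    have "(\<integral>x. W D v x \<partial>M) = 1 / 2 * Re (\<integral>x. (\<Sum>i\<in>UNIV. Dw i x * cnj (D i x)) \<partial>M)
       + Re (\<integral>x. (w x - u x) / of_real \<tau> * cnj (v x) \<partial>M) + \<alpha> * Re (\<integral>x. w x * cnj (v x) \<partial>M)
       - Re (\<integral>x. (of_real (\<alpha> - P x + s x) * u x + of_real \<Omega> * Lu x) * cnj (v x) \<partial>M)"
      unfolding W_def integral_Re[OF i1, symmetric] integral_Re[OF i2, symmetric]
        integral_Re[OF i3, symmetric] integral_Re[OF i4, symmetric]
      using i[THEN integrable_Re]
      by (simp only: Bochner_Integration.integral_add Bochner_Integration.integral_diff integral_mult_right_zero
         Bochner_Integration.integrable_add integrable_mult_right)
    then show "(\<integral>x. W D v x \<partial>M) = 0"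
      using arg_cong[OF weak[OF vD], of Re] by simp
  qed
  define H where "H x = Re (Lw x * cnj (u x)) - Re (Lu x * cnj (w x))" for x
  have H: "integrable M H" "(\<integral>x. H x \<partial>M) = 0"
    using herm integrable_Re[OF prod[OF L2(3,2)]] integrable_Re[OF prod[OF L2(4,1)]]
      integral_Re[OF prod[OF L2(3,2)]] integral_Re[OF prod[OF L2(4,1)]]
    unfolding H_def by auto
  have S: "integrable M (\<lambda>x. s x * ((norm (w x))\<^sup>2 - (norm (u x))\<^sup>2))"
    using Pw(2)[OF L2(1)] Pw(2)[OF L2(2)] by (simp add: right_diff_distrib)
  have le: "AE x in M. q Dw w Lw x - q Du u Lu x \<le>
      s x * ((norm (w x))\<^sup>2 - (norm (u x))\<^sup>2) + 2 * (W Dw w x - W Du u x) - \<Omega> * H x"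
    using stab
  proof eventually_elim
    case (elim x)
    let ?Gw = "\<Sum>i\<in>UNIV. (norm (Dw i x))\<^sup>2" and ?Gu = "\<Sum>i\<in>UNIV. (norm (Du i x))\<^sup>2"
      and ?Gwu = "Re (\<Sum>i\<in>UNIV. Dw i x * cnj (Du i x))"
    \<comment> \<open>Polarization of the squared gradient of w - u.\<close>
    have Ge: "(\<Sum>i\<in>UNIV. (norm (Dw i x - Du i x))\<^sup>2) = ?Gw + ?Gu - 2 * ?Gwu"
      unfolding Re_sum sum.distrib[symmetric] sum_distrib_left sum_subtractf[symmetric] cmod_power2
      by (intro sum.cong) (auto simp: power2_eq_square algebra_simps)
    have Gw: "Re (\<Sum>i\<in>UNIV. Dw i x * cnj (Dw i x)) = ?Gw"
      unfolding Re_sum cmod_power2 by (simp add: power2_eq_square)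
    have "0 \<le> 2 / \<tau> * (norm (w x - u x))\<^sup>2" using \<tau> by simp
    then show ?case
      using elim energy_difference_identity[OF Ge, where P="P x" and w="w x" and u="u x" and Lw="Lw x" and Lu="Lu x" and s="s x" and \<alpha>=\<alpha> and \<Omega>=\<Omega> and \<tau>=\<tau>]
      unfolding q_def W_def H_def Gw by linarith
  qed
  have WW: "integrable M (W Dw w)" "integrable M (W Du u)" "(\<integral>x. W Dw w x \<partial>M) = 0" "(\<integral>x. W Du u x \<partial>M) = 0"
    by (intro W; simp)+
  have R: "integrable M (\<lambda>x. s x * ((norm (w x))\<^sup>2 - (norm (u x))\<^sup>2) + 2 * (W Dw w x - W Du u x) - \<Omega> * H x)"
    by (intro Bochner_Integration.integrable_add Bochner_Integration.integrable_diff integrable_mult_right S WW H)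
  have "(\<integral>x. q Dw w Lw x - q Du u Lu x \<partial>M) \<le>
      (\<integral>x. s x * ((norm (w x))\<^sup>2 - (norm (u x))\<^sup>2) + 2 * (W Dw w x - W Du u x) - \<Omega> * H x \<partial>M)"
    using le by (intro integral_mono_AE R Bochner_Integration.integrable_diff q L2)
  also have "\<dots> = (\<integral>x. s x * ((norm (w x))\<^sup>2 - (norm (u x))\<^sup>2) \<partial>M)"
    using S WW H by simp
  finally show ?thesis
    using q L2 by simp
qed

section \<open>Homogeneity of the energy under normalisation\<close>

lemma weak_partial_scale_AE:
  assumes U: "open U" and w: "w \<in> H1_space U" and eq: "AE x in lebesgue_on U. v x = c * w x"
  shows "AE x in lebesgue_on U. weak_partial U i v x = c * weak_partial U i w x"
proof -
  have Um: "U \<in> sets lebesgue" using U by auto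
  have "AE x in lebesgue_on U. c * w x = v x" using eq by eventually_elim simp
  from has_weak_partial_cong_AE[OF Um this has_weak_partial_cmult[OF H1_space_weak_partial(1)[OF U w]]]
  show ?thesis by (rule weak_partial_AE_eq[OF U])
qed

text \<open>The normalised iterate is a multiple of w only almost everywhere, and the same holds for
  its chosen derivatives, so the integrands are compared off a null set. The real factor c enters
  each quadratic term as its square.\<close>

lemma energy_Q_scale:
  assumes U: "open U" and w: "w \<in> H1_space U" and eq: "AE x in lebesgue_on U. v x = of_real c * w x"
  shows "energy_Q U i1 i2 \<Omega> \<omega> V v = c\<^sup>2 * energy_Q U i1 i2 \<Omega> \<omega> V w"
proof -
  let ?M = "lebesgue_on U"
  let ?E = "\<lambda>v x. of_real (1 / 2 * (\<Sum>i\<in>UNIV. (norm (weak_partial U i v x))\<^sup>2)) + of_real (V x * (norm (v x))\<^sup>2)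
    - of_real \<Omega> * cnj (v x) * Lz U i1 i2 v x + of_real (\<omega> * (norm (v x))\<^sup>2)"
  have "AE x in ?M. \<forall>i. weak_partial U i v x = of_real c * weak_partial U i w x"
    using weak_partial_scale_AE[OF U w eq] by (simp add: AE_all_countable)
  then have "AE x in ?M. ?E v x = of_real (c\<^sup>2) * ?E w x"
    using eq
  proof eventually_elim
    case (elim x)
    then have D: "weak_partial U i v x = of_real c * weak_partial U i w x" for i by blast
    have "Lz U i1 i2 v x = of_real c * Lz U i1 i2 w x"
      by (simp add: Lz_def D algebra_simps)
    moreover have "(\<Sum>i\<in>UNIV. (norm (weak_partial U i v x))\<^sup>2) = c\<^sup>2 * (\<Sum>i\<in>UNIV. (norm (weak_partial U i w x))\<^sup>2)"
      by (simp add: D norm_mult power_mult_distrib sum_distrib_left)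
    moreover have "(norm (v x))\<^sup>2 = c\<^sup>2 * (norm (w x))\<^sup>2" "cnj (v x) = of_real c * cnj (w x)"
      using elim(2) by (simp_all add: norm_mult power_mult_distrib)
    ultimately show ?case
      by (simp add: algebra_simps) (simp add: power2_eq_square)
  qed
  then have "(\<integral>x. ?E v x \<partial>?M) = (\<integral>x. of_real (c\<^sup>2) * ?E w x \<partial>?M)"
    by (intro lebesgue_on_cong_AE(2)) (use U in auto)
  also have "\<dots> = of_real (c\<^sup>2) * (\<integral>x. ?E w x \<partial>?M)"
    by (rule integral_mult_right_zero)
  finally have eq': "(\<integral>x. ?E v x \<partial>?M) = of_real (c\<^sup>2) * (\<integral>x. ?E w x \<partial>?M)" .
  have "Re (of_real r * z) = r * Re z" for r z by simp
  then show ?thesis unfolding energy_Q_def eq' .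
qed

section \<open>Hoelder's inequality for the nonlinear term\<close>

lemma powr_Young:
  fixes a b p :: real
  assumes "1 < p" "0 \<le> a" "0 \<le> b"
  shows "a powr (p - 1) * b\<^sup>2 \<le> (p - 1) / (p + 1) * a powr (p + 1) + 2 / (p + 1) * b powr (p + 1)"
proof -
  \<comment> \<open>The exponents (p + 1) / (p - 1) and (p + 1) / 2 are conjugate and turn both
    factors into powers of order p + 1.\<close>
  have "a powr (p - 1) * b powr 2 \<le> (a powr (p - 1)) powr ((p + 1) / (p - 1)) / ((p + 1) / (p - 1))
      + (b powr 2) powr ((p + 1) / 2) / ((p + 1) / 2)"
  proof (rule Youngs_inequality)
    have "(p - 1) / (p + 1) + 2 / (p + 1) = 1" using assms(1) by (simp flip: add_divide_distrib)
    then show "1 / ((p + 1) / (p - 1)) + 1 / ((p + 1) / 2) = 1" by simp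
  qed (use assms in auto)
  also have "\<dots> = (p - 1) / (p + 1) * a powr (p + 1) + 2 / (p + 1) * b powr (p + 1)"
  proof -
    have "(p - 1) * ((p + 1) / (p - 1)) = p + 1" "2 * ((p + 1) / 2) = p + 1" using assms(1) by auto
    then show ?thesis by (simp only: powr_powr) (simp add: mult.commute)
  qed
  finally show ?thesis using assms(3) by (cases "b = 0") auto
qed

text \<open>Young's inequality is applied to |u| and |w| / N, both of unit norm, and the
  coefficients (p - 1) / (p + 1) and 2 / (p + 1) add up to 1. The same pointwise bound yields
  integrability of the left side.\<close>

lemma weighted_L2_le_Lp:
  fixes u w :: "'a \<Rightarrow> complex"
  assumes p: "1 < p"
    and u: "u \<in> borel_measurable M" "integrable M (\<lambda>x. norm (u x) powr (p + 1))" "(\<integral>x. norm (u x) powr (p + 1) \<partial>M) = 1"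
    and w: "w \<in> borel_measurable M" "integrable M (\<lambda>x. norm (w x) powr (p + 1))"
      "(\<integral>x. norm (w x) powr (p + 1) \<partial>M) = N powr (p + 1)"
    and N: "0 < N"
  shows "(\<integral>x. norm (u x) powr (p - 1) * (norm (w x))\<^sup>2 \<partial>M) \<le> N\<^sup>2"
proof -
  let ?R = "\<lambda>x. N\<^sup>2 * ((p - 1) / (p + 1) * norm (u x) powr (p + 1) + 2 / (p + 1) * (norm (w x) powr (p + 1) / N powr (p + 1)))"
  have R: "integrable M ?R" using u w by simp
  have le: "norm (u x) powr (p - 1) * (norm (w x))\<^sup>2 \<le> ?R x" for x
  proof -
    have "norm (u x) powr (p - 1) * (norm (w x))\<^sup>2 = N\<^sup>2 * (norm (u x) powr (p - 1) * (norm (w x) / N)\<^sup>2)"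
      using N by (simp add: power_divide)
    also have "\<dots> \<le> N\<^sup>2 * ((p - 1) / (p + 1) * norm (u x) powr (p + 1) + 2 / (p + 1) * (norm (w x) / N) powr (p + 1))"
      using p N by (intro mult_left_mono powr_Young) auto
    also have "\<dots> = ?R x" using N by (simp add: powr_divide)
    finally show ?thesis .
  qed
  have "(\<integral>x. norm (u x) powr (p - 1) * (norm (w x))\<^sup>2 \<partial>M) \<le> (\<integral>x. ?R x \<partial>M)"
  proof (rule integral_mono_AE[OF _ R AE_I2[OF le]])
    show "integrable M (\<lambda>x. norm (u x) powr (p - 1) * (norm (w x))\<^sup>2)"
    proof (rule Bochner_Integration.integrable_bound[OF R])
      show "AE x in M. norm (norm (u x) powr (p - 1) * (norm (w x))\<^sup>2) \<le> norm (?R x)"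
      proof (rule AE_I2)
        fix x
        have "0 \<le> norm (u x) powr (p - 1) * (norm (w x))\<^sup>2" by simp
        with le[of x] show "norm (norm (u x) powr (p - 1) * (norm (w x))\<^sup>2) \<le> norm (?R x)"
          unfolding real_norm_def by linarith
      qed
    qed (use u w in measurable)
  qed
  also have "\<dots> = N\<^sup>2 * ((p - 1) / (p + 1) * 1 + 2 / (p + 1) * (N powr (p + 1) / N powr (p + 1)))"
    using u w by (simp del: divide_self_if)
  also have "\<dots> = N\<^sup>2 * ((p - 1) / (p + 1) + 2 / (p + 1))" using N by simp
  also have "(p - 1) / (p + 1) + 2 / (p + 1) = 1" using p by (simp flip: add_divide_distrib)
  finally show ?thesis by simp
qed

lemma Lp_norm_powr:
  assumes "0 < q"
  shows "Lp_norm U q u powr q = (\<integral>x. norm (u x) powr q \<partial>lebesgue_on U)"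
  using assms by (simp add: Lp_norm_def powr_powr Bochner_Integration.integral_nonneg)

section \<open>Stability bound and symmetry of the angular momentum\<close>

lemma Lz_stability:
  fixes e :: complex and D :: "'n::finite \<Rightarrow> complex" and c1 c2 :: real
  assumes c: "i1 = i2 \<Longrightarrow> c1 = 0 \<and> c2 = 0"
    and \<beta>: "\<Omega>\<^sup>2 / 2 * (c1\<^sup>2 + c2\<^sup>2) \<le> \<beta>"
  shows "0 \<le> 1 / 2 * (\<Sum>i\<in>UNIV. (norm (D i))\<^sup>2) + \<beta> * (norm e)\<^sup>2
     + \<Omega> * Re (\<i> * (of_real c2 * D i1 - of_real c1 * D i2) * cnj e)"
proof -
  have \<beta>e: "\<Omega>\<^sup>2 / 2 * (c1\<^sup>2 + c2\<^sup>2) * (norm e)\<^sup>2 \<le> \<beta> * (norm e)\<^sup>2"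
    using \<beta> by (intro mult_right_mono) auto
  show ?thesis
  proof (cases "i1 = i2")
    \<comment> \<open>Both coefficients vanish, so the hypothesis on \<beta> reduces to \<beta>
      being nonnegative.\<close>
    case True
    with c have c0: "c1 = 0" "c2 = 0" by auto
    with \<beta>e have "0 \<le> \<beta> * (norm e)\<^sup>2" by simp
    then show ?thesis using c0 by (simp add: sum_nonneg)
  next
    case False
    \<comment> \<open>Distinct indices make the two derivatives different summands of the squared
      gradient; the others are dropped.\<close>
    have "(\<Sum>i\<in>{i1, i2}. (norm (D i))\<^sup>2) \<le> (\<Sum>i\<in>UNIV. (norm (D i))\<^sup>2)"
      by (rule sum_mono2) auto
    then have sum: "(norm (D i1))\<^sup>2 + (norm (D i2))\<^sup>2 \<le> (\<Sum>i\<in>UNIV. (norm (D i))\<^sup>2)"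
      using False by simp
    \<comment> \<open>The shifts are chosen so that the cross terms form exactly the angular
      momentum pairing; their own squares give the term with
      \<open>\<Omega>\<^sup>2 / 2\<close>.\<close>
    have "0 \<le> 1 / 2 * (norm (D i1 - of_real (\<Omega> * c2) * \<i> * e))\<^sup>2 + 1 / 2 * (norm (D i2 + of_real (\<Omega> * c1) * \<i> * e))\<^sup>2"
      by simp
    also have "\<dots> = 1 / 2 * ((norm (D i1))\<^sup>2 + (norm (D i2))\<^sup>2) + \<Omega>\<^sup>2 / 2 * (c1\<^sup>2 + c2\<^sup>2) * (norm e)\<^sup>2
      + \<Omega> * Re (\<i> * (of_real c2 * D i1 - of_real c1 * D i2) * cnj e)"
      unfolding cmod_power2 by (simp add: power2_eq_square algebra_simps add_divide_distrib)
    finally have sq: "0 \<le> \<dots>" .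
    have "0 \<le> 1 / 2 * y + y' + z" if "0 \<le> 1 / 2 * x + x' + z" "x \<le> y" "x' \<le> y'" for x x' y y' z :: real
      using that by linarith
    from this[OF sq sum \<beta>e] show ?thesis .
  qed
qed

lemma Lz_L2fun:
  fixes a b :: "real ^ 'n::finite"
  assumes f: "f \<in> H1_space (box a b)"
  shows "L2fun (lebesgue_on (box a b)) (Lz (box a b) i1 i2 f)"
proof (cases "CARD('n) = 1")
  case True
  then have "Lz (box a b) i1 i2 f = (\<lambda>_. 0)" by (intro ext) (simp add: Lz_def)
  then show ?thesis by (simp add: L2fun_def)
next
  case False
  have "L2fun (lebesgue_on (box a b)) (\<lambda>x. of_real (x $ j) * weak_partial (box a b) i f x)" for i j
    using coordinate_bounded_on_box[where a=a and b=b and j=j] L2fun_bounded_mult H1_space_weak_partial(2)[OF open_box f]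
    by metis
  from L2fun_cmult[OF L2fun_diff[OF this this]] False show ?thesis
    unfolding Lz_def[abs_def] by simp
qed

text \<open>The integrands differ by \<i> times a difference of two integration by parts
  expressions, in each of which a coordinate multiplies the derivative in the other direction, so
  each integral is zero.\<close>

lemma Lz_symmetric:
  fixes a b :: "real ^ 'n::finite"
  assumes u: "u \<in> H1_bc bc a b" and v: "v \<in> H1_bc bc a b"
    and box: "box a b \<noteq> {}" and coords: "CARD('n) \<ge> 2 \<Longrightarrow> i1 \<noteq> i2"
  shows "(\<integral>x. Lz (box a b) i1 i2 u x * cnj (v x) \<partial>lebesgue_on (box a b)) =
    (\<integral>x. u x * cnj (Lz (box a b) i1 i2 v x) \<partial>lebesgue_on (box a b))"
proof (cases "CARD('n) = 1")
  case True
  then show ?thesis by (simp add: Lz_def)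
next
  case False
  let ?D = "weak_partial (box a b)" and ?M = "lebesgue_on (box a b)"
  have "0 < CARD('n)" by simp
  with False have "2 \<le> CARD('n)" by linarith
  with coords have i12: "i1 \<noteq> i2" by blast
  have H1: "u \<in> H1_space (box a b)" "v \<in> H1_space (box a b)"
    using u v by (auto intro: H1_bc_imp_H1_space)
  let ?X = "\<lambda>i j x. of_real (x $ j) * (?D i u x * cnj (v x) + u x * cnj (?D i v x))"
  have int: "integrable ?M (?X i j)" for i j
  proof -
    obtain C where m: "AE x in ?M. norm (complex_of_real (x $ j)) \<le> C"
      "(\<lambda>x. complex_of_real (x $ j)) \<in> borel_measurable ?M"
      using coordinate_bounded_on_box by blast
    note mult = L2fun_bounded_mult[OF m(2,1)]
    note L = H1_space_L2fun[OF H1(1)] H1_space_L2fun[OF H1(2)]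
      H1_space_weak_partial(2)[OF open_box H1(1), of i] H1_space_weak_partial(2)[OF open_box H1(2), of i]
    show ?thesis
      using Bochner_Integration.integrable_add[OF L2fun_mult_integrable[OF mult[OF L(3)] L2fun_cnj[OF L(2)]]
        L2fun_mult_integrable[OF mult[OF L(1)] L2fun_cnj[OF L(4)]]]
      by (simp add: distrib_left mult.assoc)
  qed
  have "(\<integral>x. Lz (box a b) i1 i2 u x * cnj (v x) \<partial>?M) - (\<integral>x. u x * cnj (Lz (box a b) i1 i2 v x) \<partial>?M)
      = (\<integral>x. Lz (box a b) i1 i2 u x * cnj (v x) - u x * cnj (Lz (box a b) i1 i2 v x) \<partial>?M)"
    by (intro Bochner_Integration.integral_diff[symmetric] L2fun_mult_integrable L2fun_cnj Lz_L2fun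
      H1_space_L2fun H1)
  also have "\<dots> = (\<integral>x. \<i> * (?X i1 i2 x - ?X i2 i1 x) \<partial>?M)"
    using False by (intro Bochner_Integration.integral_cong) (auto simp: Lz_def algebra_simps)
  also have "\<dots> = \<i> * ((\<integral>x. ?X i1 i2 x \<partial>?M) - (\<integral>x. ?X i2 i1 x \<partial>?M))"
    using int by (simp only: integral_mult_right_zero Bochner_Integration.integral_diff)
  also have "\<dots> = 0"
    using i12 H1_bc_integration_by_parts[OF u v box, of i1 i2] H1_bc_integration_by_parts[OF u v box, of i2 i1]
    by simp
  finally show ?thesis by simp
qed

theorem theorem2p4:
  fixes a b :: "real ^ 'n::finite"
    and i1 i2 :: 'n
    and \<Omega> \<omega> p \<tau> :: real
    and V :: "real ^ 'n \<Rightarrow> real"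
    and bc :: boundary_condition
    and \<alpha> :: "nat \<Rightarrow> real"
    and u ut :: "nat \<Rightarrow> real ^ 'n \<Rightarrow> complex"
    and n :: nat
  assumes box: "box a b \<noteq> {}"
    and coords: "CARD('n) \<ge> 2 \<Longrightarrow> i1 \<noteq> i2"
    and p: "1 < p" "CARD('n) \<ge> 3 \<Longrightarrow> p < (real CARD('n) + 2) / (real CARD('n) - 2)"
    and V: "V \<in> Linf_space (box a b)" "AE x in lebesgue_on (box a b). 0 \<le> V x"
    and \<tau>: "0 < \<tau>"
    and \<alpha>: "0 \<le> \<alpha> n"
    and u: "u n \<in> H1_bc bc a b" "u n \<in> Linf_space (box a b)"
    and norm_u: "Lp_norm (box a b) (p + 1) (u n) = 1"
    and Q_u: "0 \<le> energy_Q (box a b) i1 i2 \<Omega> \<omega> V (u n)"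
    and stab:
      "(CARD('n) = 1 \<and>
         ereal (\<alpha> n) \<ge> ereal (1 / 2) * max 0 (esssup (lebesgue_on (box a b)) (\<lambda>x. ereal
           (V x + \<omega>
            - lambda_tilde (box a b) i1 i2 \<Omega> \<omega> V p (u n) * norm (u n x) powr (p - 1)))))
       \<or>
       (CARD('n) \<ge> 2 \<and>
         ereal (\<alpha> n) \<ge> ereal (1 / 2) * max 0 (esssup (lebesgue_on (box a b)) (\<lambda>x. ereal
           (V x + \<bar>\<Omega>\<bar>\<^sup>2 / 2 * ((x $ i1)\<^sup>2 + (x $ i2)\<^sup>2) + \<omega>
            - lambda_tilde (box a b) i1 i2 \<Omega> \<omega> V p (u n) * norm (u n x) powr (p - 1)))))"
    and step: "bfe_step bc a b i1 i2 \<Omega> \<omega> V p \<tau> (\<alpha> n) (u n) (ut (Suc n)) (u (Suc n))"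
  shows "energy_Q (box a b) i1 i2 \<Omega> \<omega> V (u (Suc n)) \<le> energy_Q (box a b) i1 i2 \<Omega> \<omega> V (u n)"
proof -
  let ?U = "box a b" and ?M = "lebesgue_on (box a b)"
  define v where "v = u n"
  define w where "w = ut (Suc n)"
  define lam where "lam = lambda_tilde ?U i1 i2 \<Omega> \<omega> V p v"
  define N where "N = Lp_norm ?U (p + 1) w"
  define P where "P x = V x + \<omega>" for x
  define s where "s x = lam * norm (v x) powr (p - 1)" for x
  \<comment> \<open>Coordinates are set to 0 in dimension one: then the bounds (i) and (ii), and
    both branches of \<open>Lz\<close>, are covered by one formula.\<close>
  define c where "c i x = (if CARD('n) = 1 then 0 else x $ i)" for i and x :: "real ^ 'n"
  let ?Q = "energy_Q ?U i1 i2 \<Omega> \<omega> V"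
  let ?D = "weak_partial ?U" and ?L = "Lz ?U i1 i2"
  have v: "v \<in> H1_bc bc a b" using u by (simp add: v_def)
  have w: "w \<in> H1_bc bc a b"
    and weak: "\<And>\<phi>. \<phi> \<in> H1_bc bc a b \<Longrightarrow>
        (\<integral>x. (w x - v x) / of_real \<tau> * cnj (\<phi> x) \<partial>?M) =
          - 1 / 2 * (\<integral>x. (\<Sum>i\<in>UNIV. ?D i w x * cnj (?D i \<phi> x)) \<partial>?M)
          - of_real (\<alpha> n) * (\<integral>x. w x * cnj (\<phi> x) \<partial>?M)
          + (\<integral>x. (of_real (\<alpha> n - P x + s x) * v x + of_real \<Omega> * ?L v x) * cnj (\<phi> x) \<partial>?M)"
    and u': "AE x in ?M. u (Suc n) x = of_real (1 / N) * w x"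
  proof -
    note step' = step[unfolded bfe_step_def bfe_weak_solution_def Let_def, folded v_def w_def, folded lam_def N_def]
    have eq: "\<alpha> n - V x - \<omega> + lam * norm (v x) powr (p - 1) = \<alpha> n - P x + s x" for x
      by (simp add: P_def s_def)
    show "w \<in> H1_bc bc a b" using step' by blast
    show "(\<integral>x. (w x - v x) / of_real \<tau> * cnj (\<phi> x) \<partial>?M) =
          - 1 / 2 * (\<integral>x. (\<Sum>i\<in>UNIV. ?D i w x * cnj (?D i \<phi> x)) \<partial>?M)
          - of_real (\<alpha> n) * (\<integral>x. w x * cnj (\<phi> x) \<partial>?M)
          + (\<integral>x. (of_real (\<alpha> n - P x + s x) * v x + of_real \<Omega> * ?L v x) * cnj (\<phi> x) \<partial>?M)"
      if "\<phi> \<in> H1_bc bc a b" for \<phi>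
      using step' that unfolding eq by blast
    have "AE x in ?M. u (Suc n) x = w x / of_real N" using step' by blast
    then show "AE x in ?M. u (Suc n) x = of_real (1 / N) * w x" by eventually_elim simp
  qed
  have H1: "v \<in> H1_space ?U" "w \<in> H1_space ?U"
    using v w by (auto intro: H1_bc_imp_H1_space)
  have L2: "L2fun ?M v" "L2fun ?M w" "L2fun ?M (?D i v)" "L2fun ?M (?D i w)" for i
    by (intro H1_space_L2fun H1_space_weak_partial(2)[OF open_box] H1)+
  have Iv: "(\<integral>x. norm (v x) powr (p + 1) \<partial>?M) = 1"
    using Lp_norm_powr[of "p + 1" ?U v] p(1) norm_u by (simp add: v_def)
  \<comment> \<open>The integral in the denominator is 1, so the multiplier is the energy itself.
    Its sign enters when the Hoelder bound is multiplied by it, and in the bound on s.\<close>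
  have lam: "lam = ?Q v" "0 \<le> lam"
    using Iv Q_u by (simp_all add: lam_def lambda_tilde_def v_def)
  have Qu': "?Q (u (Suc n)) = (1 / N)\<^sup>2 * ?Q w"
    by (rule energy_Q_scale[OF open_box H1(2) u'])
  have N0: "0 \<le> N" by (simp add: N_def Lp_norm_def)
  obtain CV where CV: "AE x in ?M. norm (V x) \<le> CV" and Vm: "V \<in> borel_measurable ?M"
    using V by (auto simp: Linf_space_def)
  obtain Cv where Cv: "AE x in ?M. norm (v x) \<le> Cv" and vm: "v \<in> borel_measurable ?M"
    using u(2) by (auto simp: Linf_space_def v_def)
  have wm: "w \<in> borel_measurable ?M" using L2(2) by (simp add: L2fun_def)
  have Pb: "P \<in> borel_measurable ?M" "AE x in ?M. \<bar>P x\<bar> \<le> CV + \<bar>\<omega>\<bar>"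
    using Vm CV unfolding P_def by (auto elim!: eventually_mono)
  have sb: "s \<in> borel_measurable ?M" "AE x in ?M. \<bar>s x\<bar> \<le> lam * Cv powr (p - 1)"
  proof -
    show "s \<in> borel_measurable ?M" unfolding s_def using vm by measurable
    show "AE x in ?M. \<bar>s x\<bar> \<le> lam * Cv powr (p - 1)"
      using Cv by eventually_elim
        (use lam(2) p(1) in \<open>auto simp: s_def abs_mult intro!: mult_left_mono powr_mono2\<close>)
  qed
  have stab': "AE x in ?M. P x + \<Omega>\<^sup>2 / 2 * ((c i1 x)\<^sup>2 + (c i2 x)\<^sup>2) - s x \<le> 2 * \<alpha> n"
  proof -
    define f where "f x = P x + \<Omega>\<^sup>2 / 2 * ((c i1 x)\<^sup>2 + (c i2 x)\<^sup>2) - s x" for x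
    have "ereal (1 / 2) * max 0 (esssup ?M (\<lambda>x. ereal (f x))) \<le> ereal (\<alpha> n)"
      using stab
    proof (elim disjE conjE)
      assume "CARD('n) = 1" and le: "ereal (1 / 2) * max 0 (esssup ?M (\<lambda>x. ereal
           (V x + \<omega> - lambda_tilde ?U i1 i2 \<Omega> \<omega> V p (u n) * norm (u n x) powr (p - 1)))) \<le> ereal (\<alpha> n)"
      then have "f x = V x + \<omega> - lambda_tilde ?U i1 i2 \<Omega> \<omega> V p (u n) * norm (u n x) powr (p - 1)" for x
        by (simp add: f_def P_def s_def c_def lam_def v_def)
      with le show ?thesis by simp
    next
      assume "2 \<le> CARD('n)" and le: "ereal (1 / 2) * max 0 (esssup ?M (\<lambda>x. ereal
           (V x + \<bar>\<Omega>\<bar>\<^sup>2 / 2 * ((x $ i1)\<^sup>2 + (x $ i2)\<^sup>2) + \<omega>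
            - lambda_tilde ?U i1 i2 \<Omega> \<omega> V p (u n) * norm (u n x) powr (p - 1)))) \<le> ereal (\<alpha> n)"
      then have "f x = V x + \<bar>\<Omega>\<bar>\<^sup>2 / 2 * ((x $ i1)\<^sup>2 + (x $ i2)\<^sup>2) + \<omega>
            - lambda_tilde ?U i1 i2 \<Omega> \<omega> V p (u n) * norm (u n x) powr (p - 1)" for x
        by (simp add: f_def P_def s_def c_def lam_def v_def)
      with le show ?thesis by simp
    qed
    \<comment> \<open>The maximum dominates the essential supremum. Infinity is excluded by the
      finite \<open>\<alpha> n\<close>, and minus infinity satisfies the bound trivially.\<close>
    then have "esssup ?M (\<lambda>x. ereal (f x)) \<le> ereal (2 * \<alpha> n)"
      by (cases "esssup ?M (\<lambda>x. ereal (f x))") (auto simp: max_def split: if_splits)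
    with esssup_AE[of "\<lambda>x. ereal (f x)" ?M] have "AE x in ?M. f x \<le> 2 * \<alpha> n"
      by (auto elim!: eventually_mono dest: order_trans)
    then show ?thesis by (simp add: f_def)
  qed
  have Lz_c: "?L f x = \<i> * (of_real (c i2 x) * ?D i1 f x - of_real (c i1 x) * ?D i2 f x)" for f x
    by (simp add: Lz_def c_def)
  have i12: "c i1 x = 0 \<and> c i2 x = 0" if "i1 = i2" for x
  proof -
    have "\<not> 2 \<le> CARD('n)" using coords that by blast
    moreover have "0 < CARD('n)" by simp
    ultimately have "CARD('n) = 1" by linarith
    then show ?thesis by (simp add: c_def)
  qed
  \<comment> \<open>The integral of w times the conjugate of L_z v is the conjugate of that of L_z v
    times the conjugate of w, so symmetry gives equal real parts.\<close>
  have herm: "Re (\<integral>x. ?L w x * cnj (v x) \<partial>?M) = Re (\<integral>x. ?L v x * cnj (w x) \<partial>?M)"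
    using arg_cong[OF Lz_symmetric[OF w v box coords], of Re]
      arg_cong[OF Bochner_Integration.integral_cnj[of ?M "\<lambda>x. ?L v x * cnj (w x)"], of Re]
    by (simp add: mult.commute)
  \<comment> \<open>The term with \<omega> is absorbed into P.\<close>
  have E: "?Q f = Re (\<integral>x. of_real (1 / 2 * (\<Sum>i\<in>UNIV. (norm (?D i f x))\<^sup>2)) + of_real (P x * (norm (f x))\<^sup>2)
      - of_real \<Omega> * cnj (f x) * ?L f x \<partial>?M)" for f
    unfolding energy_Q_def P_def by (simp add: algebra_simps)
  have "?Q w - ?Q v \<le> (\<integral>x. s x * ((norm (w x))\<^sup>2 - (norm (v x))\<^sup>2) \<partial>?M)"
    unfolding E
  proof (rule energy_difference_le[OF L2(2,1) _ _ L2(4,3) Pb sb \<tau> _ herm])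
    show "L2fun ?M (?L w)" "L2fun ?M (?L v)" using H1 by (auto intro: Lz_L2fun)
    show "(\<integral>x. (w x - v x) / of_real \<tau> * cnj (\<phi> x) \<partial>?M) =
          - 1 / 2 * (\<integral>x. (\<Sum>i\<in>UNIV. ?D i w x * cnj (D i x)) \<partial>?M)
          - of_real (\<alpha> n) * (\<integral>x. w x * cnj (\<phi> x) \<partial>?M)
          + (\<integral>x. (of_real (\<alpha> n - P x + s x) * v x + of_real \<Omega> * ?L v x) * cnj (\<phi> x) \<partial>?M)"
      if "(\<phi>, D) \<in> {(w, \<lambda>i. ?D i w), (v, \<lambda>i. ?D i v)}" for \<phi> D
      using that weak[OF w] weak[OF v] by auto
    show "AE x in ?M. 0 \<le> 1 / 2 * (\<Sum>i\<in>UNIV. (norm (?D i w x - ?D i v x))\<^sup>2)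
       + (2 * \<alpha> n - P x + s x) * (norm (w x - v x))\<^sup>2 + \<Omega> * Re ((?L w x - ?L v x) * cnj (w x - v x))"
      using stab'
    proof eventually_elim
      case (elim x)
      have L: "?L w x - ?L v x = \<i> * (of_real (c i2 x) * (?D i1 w x - ?D i1 v x) - of_real (c i1 x) * (?D i2 w x - ?D i2 v x))"
        unfolding Lz_c by (simp add: algebra_simps)
      \<comment> \<open>Here \<beta> is \<open>2 * \<alpha> n - P x + s x\<close>, and
        \<open>stab'\<close> is exactly the lower bound on it that is asked for.\<close>
      show ?case unfolding L by (rule Lz_stability[OF i12]) (use elim in auto)
    qed
  qed
  moreover have "(\<integral>x. s x * ((norm (w x))\<^sup>2 - (norm (v x))\<^sup>2) \<partial>?M) =
      lam * (\<integral>x. norm (v x) powr (p - 1) * (norm (w x))\<^sup>2 \<partial>?M) - lam"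
  proof -
    have "L2fun ?M (\<lambda>x. of_real (norm (v x) powr (p - 1)) * f x)" if "L2fun ?M f" for f
    proof (rule L2fun_bounded_mult[OF _ _ that])
      show "AE x in ?M. norm (complex_of_real (norm (v x) powr (p - 1))) \<le> Cv powr (p - 1)"
        using Cv by eventually_elim (use p(1) in \<open>auto intro!: powr_mono2\<close>)
    qed (use vm in measurable)
    note * = L2fun_mult_integrable[OF this L2fun_cnj, THEN integrable_Re]
    have int: "integrable ?M (\<lambda>x. norm (v x) powr (p - 1) * (norm (f x))\<^sup>2)" if "L2fun ?M f" for f
      using *[OF that that] by (simp add: mult.assoc complex_mult_cnj flip: cmod_power2)
    \<comment> \<open>The exponents add up to p + 1, so the part belonging to v integrates to 1 and
      leaves the summand -lam.\<close>
    have "norm (v x) powr (p - 1) * (norm (v x))\<^sup>2 = norm (v x) powr (p + 1)" for x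
      using powr_add[of "norm (v x)" "p - 1" 2] by (cases "v x = 0") (simp_all add: add.commute)
    then have "(\<integral>x. norm (v x) powr (p - 1) * (norm (v x))\<^sup>2 \<partial>?M) = 1"
      using Iv by simp
    moreover have "s x * ((norm (w x))\<^sup>2 - (norm (v x))\<^sup>2) =
        lam * (norm (v x) powr (p - 1) * (norm (w x))\<^sup>2 - norm (v x) powr (p - 1) * (norm (v x))\<^sup>2)" for x
      by (simp add: s_def algebra_simps)
    ultimately show ?thesis
      using int[OF L2(1)] int[OF L2(2)] by (simp add: right_diff_distrib)
  qed
  ultimately have Qw: "?Q w \<le> lam * (\<integral>x. norm (v x) powr (p - 1) * (norm (w x))\<^sup>2 \<partial>?M)"
    using lam(1) by linarith
  show ?thesis
  proof (cases "N = 0") \<comment> \<open>this includes the case of a divergent \<open>L\<^sup>p\<^sup>+\<^sup>1\<close> norm, whose junk value is \<open>0\<close>\<close>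
    case True
    \<comment> \<open>Division by zero makes 1 / N equal to 0, so \<open>Qu'\<close> gives the new
      iterate energy 0.\<close>
    then show ?thesis using Qu' Q_u by simp
  next
    case False
    with N0 have N: "0 < N" by simp
    have Iw: "(\<integral>x. norm (w x) powr (p + 1) \<partial>?M) = N powr (p + 1)"
      using Lp_norm_powr[of "p + 1" ?U w] p(1) by (simp add: N_def)
    have "(\<integral>x. norm (v x) powr (p - 1) * (norm (w x))\<^sup>2 \<partial>?M) \<le> N\<^sup>2"
    proof (rule weighted_L2_le_Lp[OF p(1) vm _ Iv wm _ Iw N])
      \<comment> \<open>A function that is not integrable has integral 0 by default, but these
        integrals are 1 and a power of the positive N.\<close>
      show "integrable ?M (\<lambda>x. norm (v x) powr (p + 1))" "integrable ?M (\<lambda>x. norm (w x) powr (p + 1))"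
        using Iv Iw N not_integrable_integral_eq by fastforce+
    qed
    then have "?Q w \<le> lam * N\<^sup>2"
      using Qw mult_left_mono[OF _ lam(2)] order_trans by blast
    then show ?thesis
      using N unfolding Qu' lam(1) v_def by (simp add: power_divide pos_divide_le_eq)
  qed
qed

end
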